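(* (i) If a sequence $\bar p=(p(1),p(2),\dots)$, $0\le p(i)\le 1$, contains only finitely many non-zero terms, then for every first order sentence $\psi$ from $L^c_{\le}$ a zero-one law holds, i.e. the probability that $C(n,\bar p)$ satisfies $\psi$ converges, as $n\to\infty$, to either $0$ or $1$. (ii) For every infinite sequence $\bar a=(a(1),a(2),\dots)$ such that $0<a(i)<1$ for $i=1,2,\dots$, there exist a sequence $\bar p$ obtained from $\bar a$ by the addition of some number of zero terms and a first order sentence $\psi$ from $L^c$ such that, writing $P_n$ for the probability that $C(n,\bar p)$ satisfies $\psi$, we have $\liminf_{n\to\infty}P_n=0$ but $\limsup_{n\to\infty}P_n=1$.
   Context: For a sequence $\bar p=(p(1),p(2),\dots)$ with $0\le p(i)\le 1$, $C(n,\bar p)$ is the random graph with vertex set $[n]=\{1,\dots,n\}$ in which each pair of distinct vertices $v,w$ is an edge with probability $p(\min\{|v-w|,\,n-|v-w|\})$, independently for each pair. $L^c$ is first order logic with equality whose only other predicate is the binary adjacency predicate. $L^c_{\le}$ is first order logic with equality, the binary adjacency predicate and a ternary predicate $C$, interpreted on $[n]$ as clockwise (cyclic) order: $C(v_1,v_2,v_3)$ holds if and only if $v_{\sigma(1)}\le v_{\sigma(2)}\le v_{\sigma(3)}$ for some cyclic permutation $\sigma$ of $\{1,2,3\}$. A sequence $\bar p$ is obtained from $\bar a$ by addition of zero terms if there is a strictly increasing function $f:\{1,2,\dots\}\to\{1,2,\dots\}$ with $p(f(i))=a(i)$ for all $i$ and $p(j)=0$ for every $j$ not in the image of $f$. 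*)

theory Defs
  imports "HOL-Probability.Probability"
begin

text \<open>
  Formulas of \<open>L\<^sup>c\<^sub>\<le>\<close> with variables indexed by natural numbers. The remaining connectives and
  the universal quantifier are definable from the ones given here.
\<close>

datatype fm =
    Eq nat nat
  | Adj nat nat
  | Cyc nat nat nat
  | Neg fm
  | Conj fm fm
  | Exists nat fm

primrec free_vars :: "fm \<Rightarrow> nat set" where
  "free_vars (Eq x y) = {x, y}"
| "free_vars (Adj x y) = {x, y}"
| "free_vars (Cyc x y z) = {x, y, z}"
| "free_vars (Neg \<phi>) = free_vars \<phi>"
| "free_vars (Conj \<phi> \<psi>) = free_vars \<phi> \<union> free_vars \<psi>"
| "free_vars (Exists x \<phi>) = free_vars \<phi> - {x}"

definition is_sentence :: "fm \<Rightarrow> bool" where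
  "is_sentence \<phi> \<longleftrightarrow> free_vars \<phi> = {}"

text \<open>The formulas of the sublanguage \<open>L\<^sup>c\<close>, which lacks the cyclic order predicate.\<close>

primrec order_free :: "fm \<Rightarrow> bool" where
  "order_free (Eq x y) \<longleftrightarrow> True"
| "order_free (Adj x y) \<longleftrightarrow> True"
| "order_free (Cyc x y z) \<longleftrightarrow> False"
| "order_free (Neg \<phi>) \<longleftrightarrow> order_free \<phi>"
| "order_free (Conj \<phi> \<psi>) \<longleftrightarrow> order_free \<phi> \<and> order_free \<psi>"
| "order_free (Exists x \<phi>) \<longleftrightarrow> order_free \<phi>"

definition clockwise :: "nat \<Rightarrow> nat \<Rightarrow> nat \<Rightarrow> bool" where
  "clockwise u v w \<longleftrightarrow> (u \<le> v \<and> v \<le> w) \<or> (v \<le> w \<and> w \<le> u) \<or> (w \<le> u \<and> u \<le> v)"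

text \<open>
  A graph on \<open>{1..n}\<close> is given by its set \<open>E\<close> of edges, each edge being a two-element set.
\<close>

primrec sat :: "nat \<Rightarrow> nat set set \<Rightarrow> (nat \<Rightarrow> nat) \<Rightarrow> fm \<Rightarrow> bool" where
  "sat n E s (Eq x y) \<longleftrightarrow> s x = s y"
| "sat n E s (Adj x y) \<longleftrightarrow> {s x, s y} \<in> E"
| "sat n E s (Cyc x y z) \<longleftrightarrow> clockwise (s x) (s y) (s z)"
| "sat n E s (Neg \<phi>) \<longleftrightarrow> \<not> sat n E s \<phi>"
| "sat n E s (Conj \<phi> \<psi>) \<longleftrightarrow> sat n E s \<phi> \<and> sat n E s \<psi>"
| "sat n E s (Exists x \<phi>) \<longleftrightarrow> (\<exists>v\<in>{1..n}. sat n E (s(x := v)) \<phi>)"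

lemma sat_cong_free_vars:
  "(\<And>x. x \<in> free_vars \<phi> \<Longrightarrow> s x = t x) \<Longrightarrow> sat n E s \<phi> \<longleftrightarrow> sat n E t \<phi>"
proof (induction \<phi> arbitrary: s t)
  case (Neg \<phi>)
  have "sat n E s \<phi> \<longleftrightarrow> sat n E t \<phi>"
    by (rule Neg.IH) (simp add: Neg.prems)
  then show ?case by simp
next
  case (Conj \<phi> \<psi>)
  have "sat n E s \<phi> \<longleftrightarrow> sat n E t \<phi>"
    by (rule Conj.IH(1)) (simp add: Conj.prems)
  moreover have "sat n E s \<psi> \<longleftrightarrow> sat n E t \<psi>"
    by (rule Conj.IH(2)) (simp add: Conj.prems)
  ultimately show ?case by simp
next
  case (Exists x \<phi>)
  have "sat n E (s(x := v)) \<phi> \<longleftrightarrow> sat n E (t(x := v)) \<phi>" for v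
    by (rule Exists.IH) (simp add: Exists.prems)
  then show ?case by simp
qed simp_all

definition models :: "nat \<Rightarrow> nat set set \<Rightarrow> fm \<Rightarrow> bool" where
  "models n E \<psi> \<longleftrightarrow> (\<forall>s. sat n E s \<psi>)"

text \<open>The choice of assignment is immaterial for sentences.\<close>

lemma models_iff_sat: "is_sentence \<psi> \<Longrightarrow> models n E \<psi> \<longleftrightarrow> sat n E s \<psi>"
proof -
  assume "is_sentence \<psi>"
  then have "sat n E s \<psi> \<longleftrightarrow> sat n E t \<psi>" for t
    by (intro sat_cong_free_vars) (simp add: is_sentence_def)
  then show ?thesis unfolding models_def by blast
qed

definition vertex_pairs :: "nat \<Rightarrow> (nat \<times> nat) set" where
  "vertex_pairs n = {(v, w). 1 \<le> v \<and> v < w \<and> w \<le> n}"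

text \<open>
  The random graph \<open>C(n, p)\<close>, as a distribution on edge sets. Each unordered pair of vertices is
  represented by the pair \<open>(v, w)\<close> with \<open>v < w\<close>, so \<open>\<bar>v - w\<bar> = w - v\<close>. Sequences are indexed from 1:
  the argument of \<open>p\<close> is always at least 1, and the value \<open>p 0\<close> is never used.
\<close>

definition cyclic_random_graph :: "nat \<Rightarrow> (nat \<Rightarrow> real) \<Rightarrow> nat set set pmf" where
  "cyclic_random_graph n p =
     map_pmf (\<lambda>b. {{v, w} |v w. (v, w) \<in> vertex_pairs n \<and> b (v, w)})
       (Pi_pmf (vertex_pairs n) False
         (\<lambda>(v, w). bernoulli_pmf (p (min (w - v) (n - (w - v))))))"

definition sat_prob :: "nat \<Rightarrow> (nat \<Rightarrow> real) \<Rightarrow> fm \<Rightarrow> real" where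
  "sat_prob n p \<psi> = measure_pmf.prob (cyclic_random_graph n p) {E. models n E \<psi>}"

definition zero_extension :: "(nat \<Rightarrow> real) \<Rightarrow> (nat \<Rightarrow> real) \<Rightarrow> bool" where
  "zero_extension a p \<longleftrightarrow>
     (\<exists>f :: nat \<Rightarrow> nat. f ` {1..} \<subseteq> {1..} \<and> strict_mono_on {1..} f \<and>
        (\<forall>i\<ge>1. p (f i) = a i) \<and> (\<forall>j\<ge>1. j \<notin> f ` {1..} \<longrightarrow> p j = 0))"

end

theory Submission
  imports Defs
begin

text \<open>
  \<^bold>\<open>Convergence when all edges are short.\<close> Suppose that \<open>p d = 0\<close> for \<open>d > K\<close>. Label each vertex of the
  circle with the set of those \<open>d \<in> {1..K}\<close> for which it is joined to the vertex \<open>d\<close> steps ahead.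
  Once \<open>n > 2 * K\<close>, this turns \<open>C(n, p)\<close> into a cyclic word whose letters are independent, and the
  graph can be read off from the word (\<open>word_graph_of_bits\<close>). Words are compared by an
  Ehrenfeucht-Fraisse equivalence of the quantifier rank of \<open>\<psi>\<close> that also sees distances up to \<open>K\<close>.
  This equivalence is a congruence for concatenation (\<open>similar_append\<close>), has finitely many classes
  (\<open>finite_similarity_classes\<close>), and identifies high powers \<open>w ^ m\<close> and \<open>w ^ (m + 1)\<close>
  (\<open>word_similar_power\<close>). So its classes form a finite aperiodic monoid. The minimal ideal of
  such a monoid consists of elements \<open>e\<close> with \<open>e x e = e\<close> for all \<open>x\<close> (\<open>absorbing_word_exists\<close>).
  If a word representing such an \<open>e\<close> occurs anywhere on the circle, cut the circle at this occurrence to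
  get \<open>e y\<close>, which is equivalent to \<open>e e y\<close>; a rotation makes this \<open>e y e\<close>, which is equivalent to
  \<open>e\<close>. Hence \<open>e\<close> alone decides \<open>\<psi>\<close> (\<open>decisive_word_exists\<close>). A fixed word of possible letters
  occurs with probability tending to 1, because the circle contains arbitrarily many disjoint
  blocks in which it could occur.

  \<^bold>\<open>Divergence.\<close> Let \<open>\<psi>\<close> say that there is a triangle, and spread the terms of \<open>a\<close> over positions
  \<open>f 1 < f 2 < \<dots>\<close> that grow faster than a factor of 3. Three admissible distances cannot satisfy
  \<open>x + y = z\<close>, so every triangle winds around the circle, and for \<open>n = 3 * f m + 1\<close> the admissible
  distances are all too short for that: there is no triangle. For \<open>n = 3 * f m\<close> there are
  \<open>f m\<close> disjoint equilateral triangles, each present with probability \<open>(a m) ^ 3\<close>, and if \<open>f m\<close> was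
  chosen large enough depending on \<open>a m\<close> then one of them is present with probability close to 1.
\<close>

section \<open>Independent trials in product distributions\<close>

lemma prob_le_on_support:
  assumes "\<And>x. x \<in> set_pmf M \<Longrightarrow> x \<in> X \<Longrightarrow> x \<in> Y"
  shows "measure_pmf.prob M X \<le> measure_pmf.prob M Y"
proof -
  have "measure_pmf.prob M X = measure_pmf.prob M (X \<inter> set_pmf M)"
    by (simp add: measure_Int_set_pmf)
  also have "\<dots> \<le> measure_pmf.prob M Y"
    using assms by (intro measure_pmf.finite_measure_mono) auto
  finally show ?thesis .
qed

lemma prob_pair_pmf_Times:
  "measure_pmf.prob (pair_pmf M N) (A \<times> B) = measure_pmf.prob M A * measure_pmf.prob N B"
proof -
  have "measure_pmf.prob (pair_pmf M N) (A \<times> B) =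
      measure_pmf.prob (pair_pmf M N) ((A \<inter> set_pmf M) \<times> (B \<inter> set_pmf N))"
    by (subst measure_Int_set_pmf [symmetric]) (simp add: Times_Int_Times)
  then show ?thesis
    by (simp add: measure_pmf_prob_product measure_Int_set_pmf)
qed

lemma prob_Pi_pmf_agrees:
  assumes "finite S"
  shows "measure_pmf.prob (Pi_pmf S dflt D) {b. \<forall>i\<in>S. b i = g i} = (\<Prod>i\<in>S. pmf (D i) (g i))"
proof -
  have "{b. \<forall>i\<in>S. b i = g i} = Pi S (\<lambda>i. {g i})" by auto
  then show ?thesis
    by (simp add: measure_Pi_pmf_Pi [OF assms] measure_pmf_single)
qed

text \<open>
  Matching a pattern \<open>g\<close> on disjoint coordinate sets \<open>S 0, S 1, \<dots>\<close> gives independent events. Each has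
  probability at least \<open>\<delta> ^ c\<close>, the product of at most \<open>c\<close> factors that are at least \<open>\<delta>\<close>. The induction
  splits off the coordinates in \<open>S J\<close>, so independence is needed only for a product of two
  distributions.
\<close>

lemma prob_miss_all_cylinders:
  fixes S :: "nat \<Rightarrow> 'i set" and \<delta> :: real
  assumes "finite I" "\<And>j. j < J \<Longrightarrow> S j \<subseteq> I" "disjoint_family_on S {..<J}"
    and "\<And>j. j < J \<Longrightarrow> card (S j) \<le> c"
    and "\<And>j i. j < J \<Longrightarrow> i \<in> S j \<Longrightarrow> \<delta> \<le> pmf (D i) (g i)"
    and \<delta>: "0 \<le> \<delta>" "\<delta> \<le> 1"
  shows "measure_pmf.prob (Pi_pmf I dflt D) {b. \<forall>j<J. \<exists>i\<in>S j. b i \<noteq> g i} \<le> (1 - \<delta> ^ c) ^ J"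
  using assms(1-5)
proof (induction J arbitrary: I)
  case 0
  then show ?case by simp
next
  case (Suc J)
  define I' where "I' = I - S J"
  have fS: "finite (S J)" and SI: "S J \<subseteq> I"
    using Suc.prems(1,2) finite_subset by blast+
  have disj: "S j \<inter> S J = {}" if "j < J" for j
    using Suc.prems(3) that by (auto simp: disjoint_family_on_def)
  let ?P = "measure_pmf.prob (Pi_pmf (S J) dflt D)" and ?Q = "measure_pmf.prob (Pi_pmf I' dflt D)"
  have I: "I = S J \<union> I'" "S J \<inter> I' = {}" "finite I'"
    using SI Suc.prems(1) by (auto simp: I'_def)
  have "(\<lambda>(f, h) x. if x \<in> S J then f x else h x) -` {b. \<forall>j<Suc J. \<exists>i\<in>S j. b i \<noteq> g i} =
      {f. \<exists>i\<in>S J. f i \<noteq> g i} \<times> {h. \<forall>j<J. \<exists>i\<in>S j. h i \<noteq> g i}" (is "?h -` ?E = ?A \<times> ?B")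
    using disj by (fastforce simp: less_Suc_eq)
  then have "measure_pmf.prob (Pi_pmf I dflt D) ?E = ?P ?A * ?Q ?B"
    by (subst I(1)) (simp add: Pi_pmf_union fS I(2,3) prob_pair_pmf_Times)
  also have "?P ?A \<le> 1 - \<delta> ^ c"
  proof -
    have "\<delta> ^ c \<le> \<delta> ^ card (S J)"
      using \<delta> Suc.prems(4) [of J] by (intro power_decreasing) auto
    also have "\<dots> = (\<Prod>i\<in>S J. \<delta>)" by simp
    also have "\<dots> \<le> (\<Prod>i\<in>S J. pmf (D i) (g i))"
      using \<delta> Suc.prems(5) by (intro prod_mono) auto
    finally have "\<delta> ^ c \<le> ?P {b. \<forall>i\<in>S J. b i = g i}"
      by (simp add: prob_Pi_pmf_agrees fS)
    moreover have "?A = - {b. \<forall>i\<in>S J. b i = g i}" by auto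
    ultimately show ?thesis
      using measure_pmf.prob_compl [of "{b. \<forall>i\<in>S J. b i = g i}" "Pi_pmf (S J) dflt D"]
      by (simp add: Compl_eq_Diff_UNIV)
  qed
  also have "?Q ?B \<le> (1 - \<delta> ^ c) ^ J"
  proof (rule Suc.IH)
    show "S j \<subseteq> I'" if "j < J" for j
      using that disj [OF that] Suc.prems(2) [of j] by (auto simp: I'_def)
    show "disjoint_family_on S {..<J}"
      by (rule disjoint_family_on_mono [OF _ Suc.prems(3)]) auto
    show "\<delta> \<le> pmf (D i) (g i)" if "j < J" "i \<in> S j" for i j
      using that Suc.prems(5) [of j i] by simp
  qed (use I Suc.prems(4) in auto)
  finally show ?case
    using \<delta> by (simp add: mult_left_mono mult_right_mono power_le_one)
qed

section \<open>The cyclic random graph as a family of independent bits\<close>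

definition pair_distance_pmf :: "nat \<Rightarrow> (nat \<Rightarrow> real) \<Rightarrow> nat \<times> nat \<Rightarrow> bool pmf" where
  "pair_distance_pmf n p = (\<lambda>(v, w). bernoulli_pmf (p (min (w - v) (n - (w - v)))))"

definition graph_of_bits :: "nat \<Rightarrow> (nat \<times> nat \<Rightarrow> bool) \<Rightarrow> nat set set" where
  "graph_of_bits n b = {{v, w} |v w. (v, w) \<in> vertex_pairs n \<and> b (v, w)}"

abbreviation bits_pmf :: "nat \<Rightarrow> (nat \<Rightarrow> real) \<Rightarrow> (nat \<times> nat \<Rightarrow> bool) pmf" where
  "bits_pmf n p \<equiv> Pi_pmf (vertex_pairs n) False (pair_distance_pmf n p)"

lemma finite_vertex_pairs: "finite (vertex_pairs n)"
  by (rule finite_subset [of _ "{..n} \<times> {..n}"]) (auto simp: vertex_pairs_def)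

lemma sat_prob_bits:
  "sat_prob n p \<psi> = measure_pmf.prob (bits_pmf n p) {b. models n (graph_of_bits n b) \<psi>}"
  unfolding sat_prob_def cyclic_random_graph_def graph_of_bits_def pair_distance_pmf_def
  by (simp add: vimage_def)

lemma edge_graph_of_bits:
  assumes "v < w"
  shows "{v, w} \<in> graph_of_bits n b \<longleftrightarrow> (v, w) \<in> vertex_pairs n \<and> b (v, w)"
proof
  assume "{v, w} \<in> graph_of_bits n b"
  then obtain v' w' where "{v, w} = {v', w'}" "(v', w') \<in> vertex_pairs n" "b (v', w')"
    by (auto simp: graph_of_bits_def)
  moreover from this assms have "v = v'" "w = w'"
    by (auto simp: doubleton_eq_iff vertex_pairs_def)
  ultimately show "(v, w) \<in> vertex_pairs n \<and> b (v, w)" by simp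
qed (auto simp: graph_of_bits_def)

lemma no_loop_graph_of_bits: "{v} \<notin> graph_of_bits n b"
  by (auto simp: graph_of_bits_def vertex_pairs_def)

lemma bits_pmf_support:
  assumes b: "b \<in> set_pmf (bits_pmf n p)" and vw: "(v, w) \<in> vertex_pairs n"
    and p01: "\<And>i. i \<ge> 1 \<Longrightarrow> 0 \<le> p i \<and> p i \<le> 1" and n: "w - v < n"
  shows "b (v, w) \<Longrightarrow> p (min (w - v) (n - (w - v))) \<noteq> 0"
    and "\<not> b (v, w) \<Longrightarrow> p (min (w - v) (n - (w - v))) \<noteq> 1"
proof -
  have "min (w - v) (n - (w - v)) \<ge> 1"
    using vw n by (auto simp: vertex_pairs_def)
  note p = p01 [OF this]
  have "b (v, w) \<in> set_pmf (pair_distance_pmf n p (v, w))"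
    using b vw by (auto simp: set_Pi_pmf finite_vertex_pairs PiE_dflt_def)
  then have "pmf (pair_distance_pmf n p (v, w)) (b (v, w)) \<noteq> 0"
    by (simp add: set_pmf_iff)
  then show "b (v, w) \<Longrightarrow> p (min (w - v) (n - (w - v))) \<noteq> 0"
    and "\<not> b (v, w) \<Longrightarrow> p (min (w - v) (n - (w - v))) \<noteq> 1"
    using p by (auto simp: pair_distance_pmf_def)
qed

section \<open>Sparse sequences without convergence\<close>

definition triangle_sentence :: fm where
  "triangle_sentence = Exists 0 (Exists 1 (Exists 2 (Conj (Adj 0 1) (Conj (Adj 1 2) (Adj 0 2)))))"

lemma models_triangle_sentence:
  "models n E triangle_sentence \<longleftrightarrow>
     (\<exists>x\<in>{1..n}. \<exists>y\<in>{1..n}. \<exists>z\<in>{1..n}. {x, y} \<in> E \<and> {y, z} \<in> E \<and> {x, z} \<in> E)"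
  by (simp add: models_def triangle_sentence_def)

text \<open>
  If both summands are below \<open>f k\<close>, they are at most \<open>f (k - 1)\<close>, and their sum is still below \<open>f k\<close>.
\<close>

lemma sum_free_of_rapid_growth:
  fixes f :: "nat \<Rightarrow> nat"
  assumes grow: "\<And>i. 2 * f i < f (Suc i)" and pos: "\<And>i. f i \<ge> 1"
  shows "f i + f j \<noteq> f k"
proof -
  have "strict_mono f"
    by (rule strict_monoI_Suc) (metis grow le_add1 mult_2 order_le_less_trans)
  then have mono: "f i \<le> f j \<longleftrightarrow> i \<le> j" for i j
    by (simp add: strict_mono_less_eq)
  show ?thesis
  proof (cases "k \<le> i \<or> k \<le> j")
    case True
    then show ?thesis
      using mono [of k i] mono [of k j] pos [of i] pos [of j] by auto
  next
    case False
    then obtain k' where k: "k = Suc k'" "i \<le> k'" "j \<le> k'"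
      by (cases k) auto
    then show ?thesis
      using mono [of i k'] mono [of j k'] grow [of k'] by simp
  qed
qed

text \<open>
  The positions of the terms of \<open>a\<close>. The growth rate excludes triangles at \<open>n = 3 * f m + 1\<close>; the third
  condition bounds the probability that all \<open>f m\<close> equilateral triangles are missing at \<open>n = 3 * f m\<close>.
\<close>

lemma rapid_sequence_exists:
  fixes a :: "nat \<Rightarrow> real"
  assumes a: "\<And>i. i \<ge> 1 \<Longrightarrow> 0 < a i \<and> a i < 1"
  shows "\<exists>f :: nat \<Rightarrow> nat. \<forall>m. f m \<ge> 1 \<and> 3 * f m + 1 \<le> f (Suc m) \<and>
    (m \<ge> 1 \<longrightarrow> (1 - a m ^ 3) ^ f m \<le> 1 / real m)"
proof -
  have step: "\<exists>y\<ge>x. m \<ge> 1 \<longrightarrow> (1 - a m ^ 3) ^ y \<le> 1 / real m" for m x :: nat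
  proof (cases "m \<ge> 1")
    case True
    then have "0 < a m ^ 3" "a m ^ 3 < 1"
      using a [OF True] by (auto simp: power_less_one_iff)
    then have q: "\<bar>1 - a m ^ 3\<bar> < 1" "0 \<le> 1 - a m ^ 3" by auto
    then have "(\<lambda>y. (1 - a m ^ 3) ^ y) \<longlonglongrightarrow> 0"
      by (simp add: LIMSEQ_power_zero)
    then have "eventually (\<lambda>y. (1 - a m ^ 3) ^ y < 1 / real m) sequentially"
      using True by (intro order_tendstoD(2)) auto
    then obtain N where "\<And>y. y \<ge> N \<Longrightarrow> (1 - a m ^ 3) ^ y < 1 / real m"
      by (auto simp: eventually_sequentially)
    then show ?thesis
      by (intro exI [of _ "max x N"]) (auto intro: less_imp_le)
  qed auto
  have "\<exists>f. \<forall>m. (f m \<ge> 1 \<and> (m \<ge> 1 \<longrightarrow> (1 - a m ^ 3) ^ f m \<le> 1 / real m)) \<and>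
      3 * f m + 1 \<le> f (Suc m)"
  proof (rule dependent_nat_choice)
    show "\<exists>x::nat. 1 \<le> x \<and> (1 \<le> (0::nat) \<longrightarrow> (1 - a 0 ^ 3) ^ x \<le> 1 / real 0)" by auto
  next
    fix x m :: nat
    show "\<exists>y. (1 \<le> y \<and> (1 \<le> Suc m \<longrightarrow> (1 - a (Suc m) ^ 3) ^ y \<le> 1 / real (Suc m))) \<and> 3 * x + 1 \<le> y"
      using step [where x = "3 * x + 1" and m = "Suc m"] by (meson le_add2 le_trans)
  qed
  then show ?thesis by blast
qed

text \<open>
  The steps of a triangle \<open>x < y < z\<close> along the short arcs are \<open>\<pm>d1\<close>, \<open>\<pm>d2\<close>, \<open>\<pm>d3\<close> and add up to a
  multiple of \<open>n\<close>. As all three are below \<open>n / 3\<close>, this multiple is 0, so one of the distances is the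
  sum of the other two.
\<close>

lemma no_triangle_of_sum_free:
  assumes b: "b \<in> set_pmf (bits_pmf n p)"
    and p01: "\<And>i. i \<ge> 1 \<Longrightarrow> 0 \<le> p i \<and> p i \<le> 1"
    and small: "\<And>d. 1 \<le> d \<Longrightarrow> 2 * d \<le> n \<Longrightarrow> p d \<noteq> 0 \<Longrightarrow> 3 * d < n"
    and sum_free: "\<And>d e. 1 \<le> d \<Longrightarrow> 1 \<le> e \<Longrightarrow> p d \<noteq> 0 \<Longrightarrow> p e \<noteq> 0 \<Longrightarrow> p (d + e) = 0"
  shows "\<not> models n (graph_of_bits n b) triangle_sentence"
proof
  let ?E = "graph_of_bits n b"
  have dist: "\<exists>d. 1 \<le> d \<and> 3 * d < n \<and> p d \<noteq> 0 \<and> (w = v + d \<or> w + d = v + n)"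
    if "{v, w} \<in> ?E" "v < w" for v w
  proof -
    from that have *: "(v, w) \<in> vertex_pairs n" "b (v, w)"
      by (auto simp: edge_graph_of_bits)
    then have **: "1 \<le> v" "w \<le> n" by (auto simp: vertex_pairs_def)
    then have "p (min (w - v) (n - (w - v))) \<noteq> 0"
      using bits_pmf_support(1) [OF b *(1) p01 _ *(2)] that(2) by fastforce
    moreover from this have "3 * min (w - v) (n - (w - v)) < n"
      using that(2) ** by (intro small) auto
    ultimately show ?thesis
      using that(2) **
      by (intro exI [of _ "min (w - v) (n - (w - v))"]) (auto simp: min_def split: if_splits)
  qed
  have ordered: False if "{x, y} \<in> ?E" "{y, z} \<in> ?E" "{x, z} \<in> ?E" "x < y" "y < z" for x y z
  proof -
    note that' = that
    obtain d1 d2 d3 where d: "1 \<le> d1" "3 * d1 < n" "p d1 \<noteq> 0" "y = x + d1 \<or> y + d1 = x + n"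
        "1 \<le> d2" "3 * d2 < n" "p d2 \<noteq> 0" "z = y + d2 \<or> z + d2 = y + n"
        "1 \<le> d3" "3 * d3 < n" "p d3 \<noteq> 0" "z = x + d3 \<or> z + d3 = x + n"
      using dist [OF that'(1,4)] dist [OF that'(2,5)] dist [OF that'(3) less_trans [OF that'(4,5)]]
      by (elim exE conjE) (rule that)
    from d(4,8,12) have "d1 + d2 = d3 \<or> d1 + d3 = d2 \<or> d2 + d3 = d1"
      by (elim disjE) (use d(2,6,10) \<open>x < y\<close> \<open>y < z\<close> in linarith)+
    then show False
      using sum_free [of d1 d2] sum_free [of d1 d3] sum_free [of d2 d3] d by auto
  qed
  assume "models n ?E triangle_sentence"
  then obtain x y z where E: "{x, y} \<in> ?E" "{y, z} \<in> ?E" "{x, z} \<in> ?E"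
    by (auto simp: models_triangle_sentence)
  have "x \<noteq> y" "y \<noteq> z" "x \<noteq> z"
    using E no_loop_graph_of_bits [of _ n b] by auto
  moreover have "{y, x} \<in> ?E" "{z, y} \<in> ?E" "{z, x} \<in> ?E"
    using E by (simp_all add: insert_commute)
  ultimately show False
    using E ordered by (metis linorder_neqE_nat)
qed

text \<open>
  The witnesses are the equilateral triangles \<open>{j, j + k, j + 2 * k}\<close>. They are edge disjoint, and
  all three sides have cyclic distance \<open>k\<close>, because the long side spans \<open>2 * k = n - k\<close>.
\<close>

lemma prob_triangle_three_times:
  assumes k: "k \<ge> 1" and pk: "0 < p k" "p k < 1"
  shows "sat_prob (3 * k) p triangle_sentence \<ge> 1 - (1 - p k ^ 3) ^ k"
proof -
  define n where "n = 3 * k"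
  define S where "S j = {(Suc j, Suc j + k), (Suc j + k, Suc j + 2 * k), (Suc j, Suc j + 2 * k)}" for j
  let ?M = "bits_pmf n p"
  let ?miss = "{b. \<forall>j<k. \<exists>i\<in>S j. b i \<noteq> True}"
  have S: "S j \<subseteq> vertex_pairs n" if "j < k" for j
    using that k by (auto simp: S_def vertex_pairs_def n_def)
  have "measure_pmf.prob ?M ?miss \<le> (1 - p k ^ 3) ^ k"
  proof (rule prob_miss_all_cylinders)
    show "disjoint_family_on S {..<k}"
      unfolding disjoint_family_on_def
    proof (intro ballI impI)
      fix i j assume "i \<in> {..<k}" "j \<in> {..<k}" "i \<noteq> j"
      then show "S i \<inter> S j = {}"
        unfolding S_def by (simp; linarith)
    qed
    show "card (S j) \<le> 3" for j
      unfolding S_def by (simp add: card_insert_if)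
    show "p k \<le> pmf (pair_distance_pmf n p i) True" if "i \<in> S j" "j < k" for i j
      using that pk by (auto simp: S_def pair_distance_pmf_def n_def min_def)
  qed (use pk S finite_vertex_pairs in auto)
  moreover have "- ?miss \<subseteq> {b. models n (graph_of_bits n b) triangle_sentence}"
  proof
    fix b assume "b \<in> - ?miss"
    then obtain j where j: "j < k" "\<forall>i\<in>S j. b i" by auto
    then have "{Suc j, Suc j + k} \<in> graph_of_bits n b" "{Suc j + k, Suc j + 2 * k} \<in> graph_of_bits n b"
        "{Suc j, Suc j + 2 * k} \<in> graph_of_bits n b"
      using S [OF j(1)] k by (subst edge_graph_of_bits; force simp: S_def)+
    moreover have "Suc j \<in> {1..n}" "Suc j + k \<in> {1..n}" "Suc j + 2 * k \<in> {1..n}"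
      using j k by (auto simp: n_def)
    ultimately show "b \<in> {b. models n (graph_of_bits n b) triangle_sentence}"
      unfolding models_triangle_sentence mem_Collect_eq by blast
  qed
  then have "measure_pmf.prob ?M (- ?miss) \<le> sat_prob n p triangle_sentence"
    unfolding sat_prob_bits by (rule measure_pmf.finite_measure_mono) simp
  moreover have "measure_pmf.prob ?M (- ?miss) = 1 - measure_pmf.prob ?M ?miss"
    using measure_pmf.prob_compl [of ?miss ?M] by (simp add: Compl_eq_Diff_UNIV)
  ultimately show ?thesis by (simp add: n_def)
qed

lemma limsup_one_liminf_zero:
  fixes P :: "nat \<Rightarrow> real" and g h :: "nat \<Rightarrow> nat"
  assumes P: "\<And>n. 0 \<le> P n" "\<And>n. P n \<le> 1"
    and g: "strict_mono g" "(\<lambda>m. P (g m)) \<longlonglongrightarrow> 0"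
    and h: "strict_mono h" "(\<lambda>m. P (h m)) \<longlonglongrightarrow> 1"
  shows "liminf (\<lambda>n. ereal (P n)) = 0" "limsup (\<lambda>n. ereal (P n)) = 1"
proof -
  have "liminf (\<lambda>n. ereal (P n)) \<le> liminf ((\<lambda>n. ereal (P n)) \<circ> g)"
    by (rule liminf_subseq_mono [OF g(1)])
  also have "\<dots> = 0"
    using g(2) by (intro lim_imp_Liminf) (auto simp: o_def zero_ereal_def)
  finally show "liminf (\<lambda>n. ereal (P n)) = 0"
    using Liminf_bounded [of 0 "\<lambda>n. ereal (P n)" sequentially] P
    by (intro antisym) auto
  have "1 = limsup ((\<lambda>n. ereal (P n)) \<circ> h)"
    using h(2) by (intro lim_imp_Limsup [symmetric]) (auto simp: o_def one_ereal_def)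
  also have "\<dots> \<le> limsup (\<lambda>n. ereal (P n))"
    by (rule limsup_subseq_mono [OF h(1)])
  finally show "limsup (\<lambda>n. ereal (P n)) = 1"
    using Limsup_bounded [of "\<lambda>n. ereal (P n)" 1 sequentially] P
    by (intro antisym) auto
qed

theorem no_convergence_for_sparse_extension:
  fixes a :: "nat \<Rightarrow> real"
  assumes a: "\<And>i. i \<ge> 1 \<Longrightarrow> 0 < a i \<and> a i < 1"
  shows "\<exists>p \<psi>. zero_extension a p \<and> is_sentence \<psi> \<and> order_free \<psi> \<and>
           liminf (\<lambda>n. ereal (sat_prob n p \<psi>)) = 0 \<and> limsup (\<lambda>n. ereal (sat_prob n p \<psi>)) = 1"
proof -
  obtain f :: "nat \<Rightarrow> nat" where f: "\<And>m. f m \<ge> 1" "\<And>m. 3 * f m + 1 \<le> f (Suc m)"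
    and q: "\<And>m. m \<ge> 1 \<Longrightarrow> (1 - a m ^ 3) ^ f m \<le> 1 / real m"
    using rapid_sequence_exists [of a] a by blast
  have f_less_Suc: "f m < f (Suc m)" for m
    using f(2) [of m] by linarith
  then have mono: "strict_mono f"
    by (rule strict_monoI_Suc)
  define p where "p j = (if j \<in> f ` {1..} then a (inv f j) else 0)" for j
  have pf: "p (f i) = a i" if "i \<ge> 1" for i
    using that strict_mono_imp_inj_on [OF mono] by (auto simp: p_def)
  have p_nz: "\<exists>i\<ge>1. j = f i" if "p j \<noteq> 0" for j
    using that by (auto simp: p_def split: if_splits)
  have p01: "0 \<le> p i \<and> p i \<le> 1" for i
    using a by (cases "p i = 0") (auto dest!: p_nz simp: pf less_imp_le)
  have ext: "zero_extension a p"
    unfolding zero_extension_def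
    using f(1) mono pf by (intro exI [of _ f]) (auto simp: p_def strict_mono_def strict_mono_on_def)
  let ?P = "\<lambda>n. sat_prob n p triangle_sentence"
  have sum_free: "p (d + e) = 0" if de: "p d \<noteq> 0" "p e \<noteq> 0" for d e
  proof (rule ccontr)
    assume "p (d + e) \<noteq> 0"
    then obtain i j k where "d = f i" "e = f j" "d + e = f k"
      using p_nz de by metis
    moreover have "2 * f m < f (Suc m)" for m
      using f(2) [of m] by linarith
    ultimately show False
      using sum_free_of_rapid_growth [of f i j k] f(1) by auto
  qed
  have zero: "?P (3 * f m + 1) = 0" for m
  proof -
    let ?n = "3 * f m + 1"
    \<comment> \<open>A cyclic distance is at most half of \<open>3 * f m + 1\<close>, which is below \<open>f (Suc m)\<close>.\<close>
    have small: "3 * d < ?n" if d: "2 * d \<le> ?n" "p d \<noteq> 0" for d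
    proof -
      obtain i where i: "d = f i" using p_nz d by auto
      have "i < Suc m"
        using d(1) f(2) [of m] f(1) [of m] strict_mono_less [OF mono, of i "Suc m"] unfolding i by linarith
      then show ?thesis
        using strict_mono_less_eq [OF mono, of i m] by (simp add: i)
    qed
    have "set_pmf (bits_pmf ?n p) \<inter> {b. models ?n (graph_of_bits ?n b) triangle_sentence} = {}"
      using no_triangle_of_sum_free [of _ ?n p] p01 small sum_free by blast
    then show ?thesis
      unfolding sat_prob_bits by (simp add: measure_pmf_zero_iff)
  qed
  have one: "(\<lambda>m. ?P (3 * f (Suc m))) \<longlonglongrightarrow> 1"
  proof (rule tendsto_sandwich)
    have "1 - 1 / real (Suc m) \<le> ?P (3 * f (Suc m))" for m
      using prob_triangle_three_times [of "f (Suc m)" p] q [of "Suc m"] f(1) a [of "Suc m"]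
      by (simp add: pf)
    then show "\<forall>\<^sub>F m in sequentially. 1 - 1 / real (Suc m) \<le> ?P (3 * f (Suc m))" by simp
    show "\<forall>\<^sub>F m in sequentially. ?P (3 * f (Suc m)) \<le> 1"
      by (simp add: sat_prob_def)
    have "(\<lambda>m. 1 - 1 / real (Suc m)) \<longlonglongrightarrow> 1 - 0"
      by (intro tendsto_diff tendsto_const) (use LIMSEQ_inverse_real_of_nat in \<open>simp add: inverse_eq_divide\<close>)
    then show "(\<lambda>m. 1 - 1 / real (Suc m)) \<longlonglongrightarrow> 1" by simp
  qed simp
  have "strict_mono (\<lambda>m. 3 * f m + 1)" "strict_mono (\<lambda>m. 3 * f (Suc m))"
    using mono by (auto simp: strict_mono_def)
  moreover have "(\<lambda>m. ?P (3 * f m + 1)) \<longlonglongrightarrow> 0"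
    unfolding zero by simp
  moreover have "0 \<le> ?P n" "?P n \<le> 1" for n
    by (simp_all add: sat_prob_def)
  ultimately have "liminf (\<lambda>n. ereal (?P n)) = 0" "limsup (\<lambda>n. ereal (?P n)) = 1"
    using limsup_one_liminf_zero [of ?P "\<lambda>m. 3 * f m + 1" "\<lambda>m. 3 * f (Suc m)"] one
    by blast+
  moreover have "is_sentence triangle_sentence" "order_free triangle_sentence"
    by (auto simp: triangle_sentence_def is_sentence_def)
  ultimately show ?thesis using ext by blast
qed

section \<open>Absorbing elements of finite aperiodic monoids of words\<close>

definition word_power :: "'c list \<Rightarrow> nat \<Rightarrow> 'c list" where
  "word_power w m = concat (replicate m w)"

lemma word_power_simps [simp]:
  "word_power w 0 = []" "word_power w (Suc m) = w @ word_power w m" "word_power [] m = []"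
  by (auto simp: word_power_def)

lemma word_power_add: "word_power w (i + j) = word_power w i @ word_power w j"
  by (induction i) auto

lemma word_power_Suc_right: "word_power w (Suc m) = word_power w m @ w"
  using word_power_add [of w m 1] by simp

lemma length_word_power [simp]: "length (word_power w m) = m * length w"
  by (induction m) auto

lemma word_power_in_lists: "w \<in> lists A \<Longrightarrow> word_power w m \<in> lists A"
  by (induction m) auto

text \<open>
  Let \<open>D z\<close> be the set of classes of words \<open>z x z\<close> and choose \<open>z\<close> with \<open>D z\<close> as small as possible. A high
  power \<open>e\<close> of \<open>z\<close> is idempotent. For \<open>y = e x e\<close> we have \<open>D y \<subseteq> D e \<subseteq> D z\<close>, and minimality turns
  these inclusions into equalities. So \<open>e\<close> is equivalent to a word \<open>y s y\<close>; iterating, \<open>e\<close> is equivalent to \<open>y ^ k t\<close>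
  for every \<open>k\<close>. When \<open>k\<close> is large, \<open>y\<close> is absorbed by \<open>y ^ k\<close>, so \<open>y = y e = y y ^ k t = y ^ k t = e\<close> up to
  equivalence. Without aperiodicity, the elements \<open>e x e\<close> would only form a group.
\<close>

lemma absorbing_word_exists:
  fixes sim :: "'c list \<Rightarrow> 'c list \<Rightarrow> bool" (infix \<open>\<sim>\<close> 50)
  assumes refl: "\<And>u. u \<sim> u" and sym: "\<And>u v. u \<sim> v \<Longrightarrow> v \<sim> u"
    and trans [trans]: "\<And>u v w. u \<sim> v \<Longrightarrow> v \<sim> w \<Longrightarrow> u \<sim> w"
    and cong: "\<And>u u' v v'. u \<sim> u' \<Longrightarrow> v \<sim> v' \<Longrightarrow> u @ v \<sim> u' @ v'"
    and aperiodic: "\<And>w. \<exists>m. word_power w m \<sim> word_power w (Suc m)"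
    and finite: "finite ((\<lambda>u. {v. u \<sim> v}) ` lists A)"
  shows "\<exists>e\<in>lists A. \<forall>x\<in>lists A. e @ x @ e \<sim> e"
proof -
  define cls where "cls u = {v. u \<sim> v}" for u
  have cls: "cls u = cls v \<longleftrightarrow> u \<sim> v" for u v
    using refl sym trans unfolding cls_def by blast
  define D where "D z = (\<lambda>x. cls (z @ x @ z)) ` lists A" for z
  have finD: "finite (D z)" if "z \<in> lists A" for z
  proof (rule finite_subset [OF _ finite])
    show "D z \<subseteq> (\<lambda>u. {v. u \<sim> v}) ` lists A"
      unfolding D_def cls_def using that by (intro image_subsetI imageI) simp
  qed
  obtain z where z: "z \<in> lists A" and min: "\<And>y. y \<in> lists A \<Longrightarrow> card (D z) \<le> card (D y)"
    using ex_has_least_nat [of "\<lambda>z. z \<in> lists A" "[]" "\<lambda>z. card (D z)"] by auto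
  obtain m0 where "word_power z m0 \<sim> word_power z (Suc m0)"
    using aperiodic by blast
  then have m: "word_power z (Suc m0) \<sim> word_power z (Suc (Suc m0))"
    using cong [OF refl [of z]] by simp
  \<comment> \<open>The exponent is positive, so that \<open>e\<close> starts and ends with \<open>z\<close>; this gives \<open>D e \<subseteq> D z\<close>.\<close>
  define e where "e = word_power z (Suc m0)"
  have e: "e \<in> lists A"
    by (simp only: e_def word_power_in_lists z)
  have "e \<sim> word_power z j @ e" for j
  proof (induction j)
    case 0
    then show ?case by (simp add: refl)
  next
    case (Suc j)
    have "e \<sim> z @ e" using m by (simp add: e_def)
    also have "z @ e \<sim> z @ word_power z j @ e" by (intro cong refl Suc)
    finally show ?case by simp
  qed
  then have ee: "e \<sim> e @ e"
    unfolding e_def by blast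
  have "e @ x @ e \<sim> e" if x: "x \<in> lists A" for x
  proof -
    define y where "y = e @ x @ e"
    have y: "y \<in> lists A" using e x by (simp add: y_def)
    have "y \<sim> e @ x @ (e @ e)"
      unfolding y_def by (intro cong refl ee)
    then have ye: "y \<sim> y @ e" by (simp add: y_def)
    have "D e \<subseteq> D z"
    proof
      fix c assume "c \<in> D e"
      then obtain s where s: "s \<in> lists A" "c = cls (e @ s @ e)" by (auto simp: D_def)
      let ?s = "word_power z m0 @ s @ word_power z m0"
      have "e @ s @ e = (z @ word_power z m0) @ s @ (word_power z m0 @ z)"
        unfolding e_def word_power_Suc_right [symmetric] by simp
      then have "c = cls (z @ ?s @ z)" by (simp add: s(2))
      moreover have "?s \<in> lists A"
        using s(1) word_power_in_lists [OF z] by simp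
      ultimately show "c \<in> D z" unfolding D_def by (rule image_eqI)
    qed
    have "D y \<subseteq> D e"
    proof
      fix c assume "c \<in> D y"
      then obtain s where s: "s \<in> lists A" "c = cls (y @ s @ y)" by (auto simp: D_def)
      then have "c = cls (e @ (x @ e @ s @ e @ x) @ e)" by (simp add: y_def)
      moreover have "x @ e @ s @ e @ x \<in> lists A" using s(1) x e by simp
      ultimately show "c \<in> D e" unfolding D_def by (rule image_eqI)
    qed
    then have "D y = D z"
      using \<open>D e \<subseteq> D z\<close> min [OF y] finD [OF z] by (meson card_seteq order_trans)
    then have "D y = D e"
      using \<open>D y \<subseteq> D e\<close> \<open>D e \<subseteq> D z\<close> by blast
    moreover have "e \<sim> e @ [] @ e" using ee by simp
    then have "cls e \<in> D e" unfolding D_def using cls by blast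
    ultimately have "cls e \<in> D y" by simp
    then obtain s where "cls e = cls (y @ s @ y)" unfolding D_def by blast
    then have s: "e \<sim> y @ s @ y" using cls by simp
    have "\<exists>t. e \<sim> word_power y j @ t" for j
    proof (induction j)
      case 0
      then show ?case using refl by auto
    next
      case (Suc j)
      then obtain t where t: "e \<sim> word_power y j @ t" by blast
      note s
      also have "y @ s @ y \<sim> (y @ e) @ s @ y" by (intro cong refl ye)
      also have "\<dots> \<sim> (y @ (word_power y j @ t)) @ s @ y" by (intro cong refl t)
      finally show ?case by auto
    qed
    moreover obtain k where k: "word_power y k \<sim> word_power y (Suc k)"
      using aperiodic by blast
    ultimately obtain t where t: "e \<sim> word_power y k @ t" by blast
    note ye
    also have "y @ e \<sim> y @ (word_power y k @ t)" by (intro cong refl t)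
    also have "\<dots> \<sim> word_power y k @ t" using cong [OF sym [OF k] refl [of t]] by simp
    also have "\<dots> \<sim> e" using t by (rule sym)
    finally show ?thesis by (simp add: y_def)
  qed
  with e show ?thesis by blast
qed

section \<open>Ehrenfeucht-Fraisse equivalence of words with marked positions\<close>

text \<open>
  Distances smaller than \<open>C\<close> are recorded exactly, all others only by their sign. With \<open>C = K + 1\<close> this
  determines which positions are at distance at most \<open>K\<close>, and, unlike exact distances, leaves finitely
  many possibilities.
\<close>

definition clip :: "nat \<Rightarrow> int \<Rightarrow> int" where
  "clip C x = max (- int C) (min (int C) x)"

lemma clip_uminus: "clip C (- x) = - clip C x"
  by (auto simp: clip_def max_def min_def)

lemma clip_eq_clip_iff:
  assumes "C > 0"
  shows "clip C x = clip C y \<longleftrightarrow> x = y \<or> (int C \<le> x \<and> int C \<le> y) \<or> (x \<le> - int C \<and> y \<le> - int C)"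
  using assms unfolding clip_def max_def min_def by (simp, linarith)

lemma clip_add:
  assumes "clip C x = clip C x'" "clip C y = clip C y'" "0 \<le> x" "0 \<le> y" "0 \<le> x'" "0 \<le> y'"
  shows "clip C (x + y) = clip C (x' + y')"
proof (cases "C = 0")
  case False
  then show ?thesis using assms by (auto simp: clip_eq_clip_iff)
qed (simp add: clip_def)

lemma clip_eq_iff:
  assumes "clip C x = clip C y" "\<bar>c\<bar> < int C"
  shows "x = c \<longleftrightarrow> y = c"
  using assms by (auto simp: clip_eq_clip_iff)

lemma clip_le_iff:
  assumes "clip C x = clip C y" "C > 0"
  shows "x \<le> 0 \<longleftrightarrow> y \<le> 0"
  using assms by (auto simp: clip_eq_clip_iff)

lemma clip_range: "clip C x \<in> {- int C..int C}"
  by (auto simp: clip_def)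

lemma clip_large: "int C \<le> x \<Longrightarrow> clip C x = int C"
  by (simp add: clip_def)

type_synonym marks = "nat \<Rightarrow> nat option"

text \<open>
  A mark assigns a position to a variable. Marks are partial because in a concatenation each variable
  lives in only one of the two factors.
\<close>

definition well_marked :: "'c list \<Rightarrow> marks \<Rightarrow> bool" where
  "well_marked u a \<longleftrightarrow> (\<forall>x p. a x = Some p \<longrightarrow> p < length u)"

lemma well_marked_upd: "well_marked u a \<Longrightarrow> p < length u \<Longrightarrow> well_marked u (a(x \<mapsto> p))"
  by (auto simp: well_marked_def)

lemma well_marked_restrict: "well_marked u a \<Longrightarrow> well_marked u (a |` X)"
  by (auto simp: well_marked_def restrict_map_def split: if_splits)

lemma well_marked_empty: "well_marked u Map.empty"
  by (simp add: well_marked_def)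

definition join_marks :: "'c list \<Rightarrow> marks \<Rightarrow> marks \<Rightarrow> marks" where
  "join_marks u a b = (\<lambda>x. case b x of Some q \<Rightarrow> Some (length u + q) | None \<Rightarrow> a x)"

lemma join_marks_eq_Some:
  "join_marks u a b x = Some p \<longleftrightarrow> (b x = None \<and> a x = Some p) \<or> (\<exists>q. b x = Some q \<and> p = length u + q)"
  by (auto simp: join_marks_def split: option.splits)

lemma dom_join_marks: "dom (join_marks u a b) = dom a \<union> dom b"
  by (auto simp: join_marks_def split: option.splits)

lemma join_marks_upd_left: "(join_marks u a b)(x \<mapsto> p) = join_marks u (a(x \<mapsto> p)) (b |` (- {x}))"
  by (auto simp: join_marks_def restrict_map_def fun_eq_iff split: option.split)

lemma join_marks_upd_right:
  "(join_marks u a b)(x \<mapsto> length u + p) = join_marks u (a |` (- {x})) (b(x \<mapsto> p))"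
  by (auto simp: join_marks_def restrict_map_def fun_eq_iff split: option.split)

text \<open>
  The quantifier-free information about marked positions. Besides letters and mutual distances it
  contains the distances to both ends of the word: these decide how a position is related to
  positions of a word that is appended, and they give the distances across the cut when the ends are
  glued to a circle. The end of the word counts as the position \<open>length u\<close>, one past the last letter.
\<close>

definition same_atomic :: "nat \<Rightarrow> 'c list \<Rightarrow> marks \<Rightarrow> 'c list \<Rightarrow> marks \<Rightarrow> bool" where
  "same_atomic C u a v b \<longleftrightarrow> dom a = dom b \<and>
     clip C (int (length u)) = clip C (int (length v)) \<and>
     (\<forall>x p q. a x = Some p \<longrightarrow> b x = Some q \<longrightarrow>
        u ! p = v ! q \<and> clip C (int p) = clip C (int q) \<and>
        clip C (int (length u) - int p) = clip C (int (length v) - int q)) \<and>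
     (\<forall>x y p p' q q'. a x = Some p \<longrightarrow> a y = Some p' \<longrightarrow> b x = Some q \<longrightarrow> b y = Some q' \<longrightarrow>
        clip C (int p' - int p) = clip C (int q' - int q))"

lemma same_atomicD:
  assumes "same_atomic C u a v b"
  shows "dom a = dom b" "clip C (int (length u)) = clip C (int (length v))"
    and "a x = Some p \<Longrightarrow> b x = Some q \<Longrightarrow> u ! p = v ! q"
    and "a x = Some p \<Longrightarrow> b x = Some q \<Longrightarrow> clip C (int p) = clip C (int q)"
    and "a x = Some p \<Longrightarrow> b x = Some q \<Longrightarrow>
      clip C (int (length u) - int p) = clip C (int (length v) - int q)"
    and "a x = Some p \<Longrightarrow> a y = Some p' \<Longrightarrow> b x = Some q \<Longrightarrow> b y = Some q' \<Longrightarrow>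
      clip C (int p' - int p) = clip C (int q' - int q)"
  using assms unfolding same_atomic_def by blast+

lemma same_atomic_refl: "same_atomic C u a u a"
  by (auto simp: same_atomic_def)

lemma same_atomic_sym:
  assumes "same_atomic C u a v b"
  shows "same_atomic C v b u a"
  unfolding same_atomic_def
  by (intro conjI allI impI; rule same_atomicD [OF assms, symmetric])

lemma same_atomic_trans:
  assumes 1: "same_atomic C u a v b" and 2: "same_atomic C v b w c"
  shows "same_atomic C u a w c"
proof -
  have b: "\<exists>q. b x = Some q" if "a x = Some p" for x p
    using same_atomicD(1) [OF 1] that by blast
  show ?thesis
    unfolding same_atomic_def
  proof (intro conjI allI impI)
    show "dom a = dom c" "clip C (int (length u)) = clip C (int (length w))"
      using same_atomicD(1,2) [OF 1] same_atomicD(1,2) [OF 2] by simp_all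
  next
    fix x p r assume x: "a x = Some p" "c x = Some r"
    then obtain q where q: "b x = Some q" using b by blast
    show "u ! p = w ! r" "clip C (int p) = clip C (int r)"
        "clip C (int (length u) - int p) = clip C (int (length w) - int r)"
      using same_atomicD(3-5) [OF 1 x(1) q] same_atomicD(3-5) [OF 2 q x(2)] by simp_all
  next
    fix x y p p' r r'
    assume xy: "a x = Some p" "a y = Some p'" "c x = Some r" "c y = Some r'"
    then obtain q q' where q: "b x = Some q" "b y = Some q'" using b by blast
    show "clip C (int p' - int p) = clip C (int r' - int r)"
      using same_atomicD(6) [OF 1 xy(1,2) q] same_atomicD(6) [OF 2 q xy(3,4)] by simp
  qed
qed

lemma same_atomic_restrict:
  assumes "same_atomic C u a v b"
  shows "same_atomic C u (a |` X) v (b |` X)"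
  unfolding same_atomic_def
proof (intro conjI allI impI)
  show "dom (a |` X) = dom (b |` X)"
    using same_atomicD(1) [OF assms] by (simp only: dom_restrict)
qed (use same_atomicD [OF assms] in \<open>auto simp: restrict_map_def split: if_splits\<close>)

text \<open>
  The distance between a mark in \<open>u\<close> and a mark in \<open>v\<close> is a sum of two nonnegative distances, one to the
  end of \<open>u\<close> and one from the start of \<open>v\<close>; the clipped summands determine the clipped sum.
\<close>

lemma same_atomic_append:
  assumes L: "same_atomic C u a u' a'" and R: "same_atomic C v b v' b'"
    and W: "well_marked u a" "well_marked u' a'" "well_marked v b" "well_marked v' b'"
    and disj: "dom a \<inter> dom b = {}"
  shows "same_atomic C (u @ v) (join_marks u a b) (u' @ v') (join_marks u' a' b')"
proof -
  note dom = same_atomicD(1) [OF L] same_atomicD(1) [OF R]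
  note len = same_atomicD(2) [OF L] same_atomicD(2) [OF R]
  have cases: "(\<exists>p0 q0. a x = Some p0 \<and> a' x = Some q0 \<and> p = p0 \<and> q = q0 \<and> p0 < length u \<and> q0 < length u') \<or>
      (\<exists>p0 q0. b x = Some p0 \<and> b' x = Some q0 \<and> p = length u + p0 \<and> q = length u' + q0 \<and>
         p0 < length v \<and> q0 < length v')"
    if "join_marks u a b x = Some p" "join_marks u' a' b' x = Some q" for x p q
    using that dom disj W unfolding join_marks_eq_Some well_marked_def by blast
  note La = same_atomicD(3-5) [OF L] and La2 = same_atomicD(6) [OF L]
  note Rb = same_atomicD(3-5) [OF R] and Rb2 = same_atomicD(6) [OF R]
  have across: "clip C (int (length u + p') - int p) = clip C (int (length u' + q') - int q)"
    if "a x = Some p" "a' x = Some q" "b y = Some p'" "b' y = Some q'" for x y p p' q q'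
  proof -
    have "p < length u" "q < length u'"
      using that W by (auto simp: well_marked_def)
    then have "clip C ((int (length u) - int p) + int p') = clip C ((int (length u') - int q) + int q')"
      using La(3) [OF that(1,2)] Rb(2) [OF that(3,4)] by (intro clip_add) auto
    then show ?thesis by (simp add: algebra_simps)
  qed
  have across': "clip C (int p - int (length u + p')) = clip C (int q - int (length u' + q'))"
    if "a x = Some p" "a' x = Some q" "b y = Some p'" "b' y = Some q'" for x y p p' q q'
    using arg_cong [OF across [OF that], of uminus] unfolding clip_uminus [symmetric] by simp
  show ?thesis
    unfolding same_atomic_def
  proof (intro conjI allI impI)
    show "dom (join_marks u a b) = dom (join_marks u' a' b')"
      by (simp add: dom_join_marks dom)
    show "clip C (int (length (u @ v))) = clip C (int (length (u' @ v')))"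
      using clip_add [OF len] by simp
  next
    fix x p q assume J: "join_marks u a b x = Some p" "join_marks u' a' b' x = Some q"
    show "(u @ v) ! p = (u' @ v') ! q"
      using cases [OF J] La(1) Rb(1) by (auto simp: nth_append)
    show "clip C (int p) = clip C (int q)"
      using cases [OF J] La(2) clip_add [OF len(1) Rb(2)] by auto
    show "clip C (int (length (u @ v)) - int p) = clip C (int (length (u' @ v')) - int q)"
      using cases [OF J]
    proof (elim disjE exE conjE)
      fix p0 q0 assume *: "a x = Some p0" "a' x = Some q0" "p = p0" "q = q0" "p0 < length u" "q0 < length u'"
      then show ?thesis
        using clip_add [OF La(3) [OF *(1,2)] len(2)] by (simp add: algebra_simps)
    qed (use Rb(3) in auto)
  next
    fix x y p p' q q'
    assume J: "join_marks u a b x = Some p" "join_marks u' a' b' x = Some q"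
      "join_marks u a b y = Some p'" "join_marks u' a' b' y = Some q'"
    show "clip C (int p' - int p) = clip C (int q' - int q)"
      using cases [OF J(1,2)] cases [OF J(3,4)]
    proof (elim disjE exE conjE)
      fix p0 q0 p1 q1
      assume "b x = Some p0" "b' x = Some q0" "p = length u + p0" "q = length u' + q0"
        "b y = Some p1" "b' y = Some q1" "p' = length u + p1" "q' = length u' + q1"
      then show ?thesis using Rb2 [of x p0 y p1 q0 q1] by simp
    qed (simp_all only: La2 across across')
  qed
qed

text \<open>
  Duplicator wins the \<open>k\<close>-round Ehrenfeucht-Fraisse game. In each round Spoiler also chooses which
  variable \<open>x \<in> V\<close> is placed, or placed anew, so that the game follows the way in which formulas
  reuse variables.
\<close>

primrec similar :: "nat \<Rightarrow> nat set \<Rightarrow> nat \<Rightarrow> 'c list \<Rightarrow> marks \<Rightarrow> 'c list \<Rightarrow> marks \<Rightarrow> bool" where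
  "similar C V 0 u a v b \<longleftrightarrow> same_atomic C u a v b"
| "similar C V (Suc k) u a v b \<longleftrightarrow> similar C V k u a v b \<and>
     (\<forall>x\<in>V. (\<forall>p<length u. \<exists>q<length v. similar C V k u (a(x \<mapsto> p)) v (b(x \<mapsto> q))) \<and>
            (\<forall>q<length v. \<exists>p<length u. similar C V k u (a(x \<mapsto> p)) v (b(x \<mapsto> q))))"

lemma similar_SucD:
  assumes "similar C V (Suc k) u a v b"
  shows "similar C V k u a v b"
    and "x \<in> V \<Longrightarrow> p < length u \<Longrightarrow> \<exists>q<length v. similar C V k u (a(x \<mapsto> p)) v (b(x \<mapsto> q))"
    and "x \<in> V \<Longrightarrow> q < length v \<Longrightarrow> \<exists>p<length u. similar C V k u (a(x \<mapsto> p)) v (b(x \<mapsto> q))"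
  using assms unfolding similar.simps by blast+

lemma similar_refl: "similar C V k u a u a"
  by (induction k arbitrary: a) (auto simp: same_atomic_refl)

lemma similar_sym: "similar C V k u a v b \<Longrightarrow> similar C V k v b u a"
proof (induction k arbitrary: a b)
  case (Suc k)
  then show ?case by (simp, blast)
qed (simp add: same_atomic_sym)

lemma similar_trans:
  "similar C V k u a v b \<Longrightarrow> similar C V k v b w c \<Longrightarrow> similar C V k u a w c"
proof (induction k arbitrary: a b c)
  case (Suc k)
  have "similar C V k u a w c" using Suc by auto
  moreover have "\<exists>q<length w. similar C V k u (a(x \<mapsto> p)) w (c(x \<mapsto> q))"
    if "x \<in> V" "p < length u" for x p
    using similar_SucD(2) [OF Suc.prems(1) that] similar_SucD(2) [OF Suc.prems(2) \<open>x \<in> V\<close>] Suc.IH by blast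
  moreover have "\<exists>p<length u. similar C V k u (a(x \<mapsto> p)) w (c(x \<mapsto> q))"
    if "x \<in> V" "q < length w" for x q
    using similar_SucD(3) [OF Suc.prems(2) that] similar_SucD(3) [OF Suc.prems(1) \<open>x \<in> V\<close>] Suc.IH by blast
  ultimately show ?case by simp
qed (auto intro: same_atomic_trans)

text \<open>
  Forgetting marks does not hurt Duplicator. This is needed when a variable that was marked in one
  factor of a concatenation is moved to the other factor.
\<close>

lemma similar_restrict: "similar C V k u a v b \<Longrightarrow> similar C V k u (a |` X) v (b |` X)"
proof (induction k arbitrary: a b X)
  case (Suc k)
  have upd: "(a |` X)(x \<mapsto> p) = (a(x \<mapsto> p)) |` insert x X" for a :: marks and x p X
    by (auto simp: restrict_map_def fun_eq_iff)
  show ?case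
    using Suc.prems Suc.IH unfolding similar.simps upd by metis
qed (simp add: same_atomic_restrict)

lemma similar_same_atomic: "similar C V k u a v b \<Longrightarrow> same_atomic C u a v b"
  by (induction k) auto

text \<open>
  Duplicator answers each move in the factor in which Spoiler played. In the other factor a round
  is given away, and the moved variable is forgotten if it was marked there.
\<close>

lemma similar_append:
  assumes "similar C V k u a u' a'" "similar C V k v b v' b'"
    and "well_marked u a" "well_marked u' a'" "well_marked v b" "well_marked v' b'"
    and "dom a \<inter> dom b = {}"
  shows "similar C V k (u @ v) (join_marks u a b) (u' @ v') (join_marks u' a' b')"
  using assms
proof (induction k arbitrary: a b a' b')
  case 0
  then show ?case by (simp add: same_atomic_append)
next
  case (Suc k)
  have left: "similar C V k (u @ v) ((join_marks u a b)(x \<mapsto> p)) (u' @ v') ((join_marks u' a' b')(x \<mapsto> q))"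
    if "similar C V k u (a(x \<mapsto> p)) u' (a'(x \<mapsto> q))" "p < length u" "q < length u'" for x p q
    unfolding join_marks_upd_left
  proof (rule Suc.IH)
    show "similar C V k u (a(x \<mapsto> p)) u' (a'(x \<mapsto> q))" by (rule that(1))
    show "well_marked u (a(x \<mapsto> p))" "well_marked u' (a'(x \<mapsto> q))"
      using Suc.prems(3,4) that by (simp_all add: well_marked_upd)
    show "similar C V k v (b |` (- {x})) v' (b' |` (- {x}))"
      using Suc.prems(2) by (simp add: similar_restrict)
    show "dom (a(x \<mapsto> p)) \<inter> dom (b |` (- {x})) = {}"
      using Suc.prems(7) unfolding dom_restrict by auto
  qed (use Suc.prems(3-6) that in \<open>simp_all add: well_marked_upd well_marked_restrict\<close>)
  have right: "similar C V k (u @ v) ((join_marks u a b)(x \<mapsto> length u + p))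
      (u' @ v') ((join_marks u' a' b')(x \<mapsto> length u' + q))"
    if "similar C V k v (b(x \<mapsto> p)) v' (b'(x \<mapsto> q))" "p < length v" "q < length v'" for x p q
    unfolding join_marks_upd_right
  proof (rule Suc.IH)
    show "similar C V k v (b(x \<mapsto> p)) v' (b'(x \<mapsto> q))" by (rule that(1))
    show "well_marked v (b(x \<mapsto> p))" "well_marked v' (b'(x \<mapsto> q))"
      using Suc.prems(5,6) that by (simp_all add: well_marked_upd)
    show "similar C V k u (a |` (- {x})) u' (a' |` (- {x}))"
      using Suc.prems(1) by (simp add: similar_restrict)
    show "dom (a |` (- {x})) \<inter> dom (b(x \<mapsto> p)) = {}"
      using Suc.prems(7) unfolding dom_restrict by auto
  qed (use Suc.prems(3-6) that in \<open>simp_all add: well_marked_upd well_marked_restrict\<close>)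
  have "\<exists>q<length (u' @ v'). similar C V k (u @ v) ((join_marks u a b)(x \<mapsto> p)) (u' @ v') ((join_marks u' a' b')(x \<mapsto> q))"
    if x: "x \<in> V" and p: "p < length (u @ v)" for x p
  proof (cases "p < length u")
    case True
    then obtain q where "q < length u'" "similar C V k u (a(x \<mapsto> p)) u' (a'(x \<mapsto> q))"
      using similar_SucD(2) [OF Suc.prems(1) x] by blast
    then show ?thesis
      using left True by (intro exI [of _ q]) auto
  next
    case False
    then obtain p0 where p0: "p = length u + p0" "p0 < length v"
      using p by (metis add_less_cancel_left le_Suc_ex length_append not_less)
    then obtain q where "q < length v'" "similar C V k v (b(x \<mapsto> p0)) v' (b'(x \<mapsto> q))"
      using similar_SucD(2) [OF Suc.prems(2) x] by blast
    then show ?thesis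
      using right p0 by (intro exI [of _ "length u' + q"]) auto
  qed
  moreover have "\<exists>p<length (u @ v). similar C V k (u @ v) ((join_marks u a b)(x \<mapsto> p)) (u' @ v') ((join_marks u' a' b')(x \<mapsto> q))"
    if x: "x \<in> V" and q: "q < length (u' @ v')" for x q
  proof (cases "q < length u'")
    case True
    then obtain p where "p < length u" "similar C V k u (a(x \<mapsto> p)) u' (a'(x \<mapsto> q))"
      using similar_SucD(3) [OF Suc.prems(1) x] by blast
    then show ?thesis
      using left True by (intro exI [of _ p]) auto
  next
    case False
    then obtain q0 where q0: "q = length u' + q0" "q0 < length v'"
      using q by (metis add_less_cancel_left le_Suc_ex length_append not_less)
    then obtain p where "p < length v" "similar C V k v (b(x \<mapsto> p)) v' (b'(x \<mapsto> q0))"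
      using similar_SucD(3) [OF Suc.prems(2) x] by blast
    then show ?thesis
      using right q0 by (intro exI [of _ "length u + p"]) auto
  qed
  moreover have "similar C V k (u @ v) (join_marks u a b) (u' @ v') (join_marks u' a' b')"
    using Suc by auto
  ultimately show ?case by simp
qed

abbreviation word_similar :: "nat \<Rightarrow> nat set \<Rightarrow> nat \<Rightarrow> 'c list \<Rightarrow> 'c list \<Rightarrow> bool" where
  "word_similar C V k u v \<equiv> similar C V k u Map.empty v Map.empty"

lemma join_marks_empty [simp]: "join_marks u a Map.empty = a"
    "join_marks u Map.empty [x \<mapsto> p] = [x \<mapsto> length u + p]"
  by (auto simp: join_marks_def fun_eq_iff)

lemma word_similar_append:
  "word_similar C V k u u' \<Longrightarrow> word_similar C V k v v' \<Longrightarrow> word_similar C V k (u @ v) (u' @ v')"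
  using similar_append [of C V k u Map.empty u' Map.empty v Map.empty v' Map.empty]
  by (simp add: well_marked_empty)

lemma similar_mark_in_middle:
  assumes "word_similar C V k u u'" "word_similar C V k v v'" "r < length w"
  shows "similar C V k (u @ w @ v) [x \<mapsto> length u + r] (u' @ w @ v') [x \<mapsto> length u' + r]"
proof -
  have "similar C V k (w @ v) (join_marks w [x \<mapsto> r] Map.empty) (w @ v') (join_marks w [x \<mapsto> r] Map.empty)"
    using assms by (intro similar_append similar_refl) (auto simp: well_marked_def)
  then have "similar C V k (u @ w @ v) (join_marks u Map.empty [x \<mapsto> r]) (u' @ w @ v') (join_marks u' Map.empty [x \<mapsto> r])"
    using assms by (intro similar_append) (auto simp: well_marked_def)
  then show ?thesis by simp
qed

text \<open>
  Spoiler marks a position in one copy of \<open>w\<close>, say with \<open>i\<close> copies before and \<open>j\<close> copies after it. One of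
  the two sides still contains about half of the copies, so by induction it can absorb the additional
  copy; the other side is kept unchanged. Hence the bound on the exponent doubles with each round,
  and for \<open>k = 0\<close> it ensures that the clipped lengths agree.
\<close>

lemma word_similar_power:
  "(C + 1) * 2 ^ k \<le> m + 1 \<Longrightarrow> word_similar C V k (word_power w m) (word_power w (Suc m))"
proof (induction k arbitrary: m)
  case 0
  show ?case
  proof (cases "w = []")
    case False
    then have "C \<le> m * length w"
      using 0 by (cases "length w") auto
    moreover have "m * length w \<le> Suc m * length w" by simp
    ultimately have "int C \<le> int (m * length w)" "int C \<le> int (Suc m * length w)"
      by linarith+
    then have "clip C (int (length (word_power w m))) = clip C (int (length (word_power w (Suc m))))"
      unfolding length_word_power by (simp only: clip_large)
    then show ?thesis
      by (simp add: same_atomic_def)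
  qed (simp add: same_atomic_refl)
next
  case (Suc k)
  \<comment> \<open>By the induction hypothesis, \<open>T - 1\<close> copies of \<open>w\<close> suffice to absorb one more.\<close>
  let ?T = "(C + 1) * 2 ^ k" and ?w = "word_power w"
  have T: "?T \<ge> 1" "2 * ?T \<le> m + 1" using Suc.prems by (simp_all add: Suc_le_eq)
  have middle: "similar C V k (?w (i + Suc j)) [x \<mapsto> i * length w + r] (?w (i' + Suc j')) [x \<mapsto> i' * length w + r]"
    if "word_similar C V k (?w i) (?w i')" "word_similar C V k (?w j) (?w j')" "r < length w" for i i' j j' r x
    using similar_mark_in_middle [OF that, of x] by (simp only: word_power_add word_power_simps length_word_power)
  have "word_similar C V k (?w m) (?w (Suc m))"
    using T by (intro Suc.IH) simp
  moreover have "\<exists>q<length (?w (Suc m)). similar C V k (?w m) [x \<mapsto> p] (?w (Suc m)) [x \<mapsto> q]"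
    if p: "p < length (?w m)" for x p
  proof -
    define i r where "i = p div length w" and "r = p mod length w"
    have "length w > 0" using p by (cases w) auto
    then have pr: "p = i * length w + r" "r < length w" and "i < m"
      using p by (auto simp: i_def r_def less_mult_imp_div_less)
    then obtain j where m: "m = i + Suc j" by (metis add_Suc_right less_imp_Suc_add)
    show ?thesis
    proof (cases "?T \<le> i + 1")
      case True
      have "similar C V k (?w (i + Suc j)) [x \<mapsto> i * length w + r] (?w (Suc i + Suc j)) [x \<mapsto> Suc i * length w + r]"
        by (rule middle [OF Suc.IH [OF True] similar_refl pr(2)])
      then show ?thesis
        using p by (intro exI [of _ "Suc i * length w + r"]) (simp add: m pr(1))
    next
      case False
      then have "?T \<le> j + 1" using T m by linarith
      then have "similar C V k (?w (i + Suc j)) [x \<mapsto> i * length w + r] (?w (i + Suc (Suc j))) [x \<mapsto> i * length w + r]"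
        by (rule middle [OF similar_refl Suc.IH pr(2)])
      then show ?thesis
        using p by (intro exI [of _ p]) (simp add: m pr(1))
    qed
  qed
  moreover have "\<exists>p<length (?w m). similar C V k (?w m) [x \<mapsto> p] (?w (Suc m)) [x \<mapsto> q]"
    if q: "q < length (?w (Suc m))" for x q
  proof -
    define i r where "i = q div length w" and "r = q mod length w"
    have "length w > 0" using q by (cases w) auto
    then have qr: "q = i * length w + r" "r < length w" and "i < Suc m"
      using q less_mult_imp_div_less [of q "Suc m" "length w"] by (auto simp: i_def r_def)
    then obtain j where m: "Suc m = i + Suc j" by (metis add_Suc_right less_imp_Suc_add)
    show ?thesis
    proof (cases "?T \<le> i")
      case True
      then obtain i0 where i: "i = Suc i0" using T by (cases i) auto
      then have "?T \<le> i0 + 1" using True by simp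
      then have "similar C V k (?w (i0 + Suc j)) [x \<mapsto> i0 * length w + r] (?w (Suc i0 + Suc j)) [x \<mapsto> Suc i0 * length w + r]"
        by (rule middle [OF Suc.IH similar_refl qr(2)])
      moreover have "m = i0 + Suc j" using m i by simp
      moreover have "i0 * length w + r < length (?w m)"
        using q by (simp add: qr(1) i)
      ultimately show ?thesis
        by (intro exI [of _ "i0 * length w + r"]) (simp add: qr(1) i)
    next
      case False
      then have "?T \<le> j" using T m by linarith
      then obtain j0 where j: "j = Suc j0" using T by (cases j) auto
      then have "?T \<le> j0 + 1" using \<open>?T \<le> j\<close> by simp
      then have "similar C V k (?w (i + Suc j0)) [x \<mapsto> i * length w + r] (?w (i + Suc (Suc j0))) [x \<mapsto> i * length w + r]"
        by (rule middle [OF similar_refl Suc.IH qr(2)])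
      moreover have "m = i + Suc j0" using m j by simp
      moreover have "i * length w + r < length (?w m)"
      proof -
        have "i * length w + r < i * length w + length w" using qr(2) by simp
        also have "\<dots> = Suc i * length w" by simp
        also have "\<dots> \<le> m * length w" using \<open>m = i + Suc j0\<close> by (intro mult_le_mono1) simp
        finally show ?thesis by simp
      qed
      ultimately show ?thesis
        by (intro exI [of _ q]) (simp add: qr(1))
    qed
  qed
  ultimately show ?case by (simp del: word_power_simps)
qed

definition marked_words :: "nat set \<Rightarrow> 'c set \<Rightarrow> ('c list \<times> marks) set" where
  "marked_words V A = {(u, a). u \<in> lists A \<and> dom a \<subseteq> V \<and> well_marked u a}"

definition similarity_class :: "nat \<Rightarrow> nat set \<Rightarrow> nat \<Rightarrow> 'c list \<Rightarrow> marks \<Rightarrow> ('c list \<times> marks) set" where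
  "similarity_class C V k u a = {(v, b). similar C V k u a v b}"

lemma similarity_class_eq_iff:
  fixes u v :: "'c list"
  shows "similarity_class C V k u a = similarity_class C V k v b \<longleftrightarrow> similar C V k u a v b"
proof
  assume *: "similarity_class C V k u a = similarity_class C V k v b"
  have "(v, b) \<in> similarity_class C V k v b"
    by (simp add: similarity_class_def similar_refl)
  then show "similar C V k u a v b"
    unfolding * [symmetric] by (simp add: similarity_class_def)
next
  assume *: "similar C V k u a v b"
  have "similar C V k u a w c \<longleftrightarrow> similar C V k v b w c" for w :: "'c list" and c
    using * similar_sym similar_trans by blast
  then show "similarity_class C V k u a = similarity_class C V k v b"
    unfolding similarity_class_def by blast
qed

lemma finite_image_via_invariant:
  assumes fin: "finite (g ` X)" and inv: "\<And>S T. S \<in> X \<Longrightarrow> T \<in> X \<Longrightarrow> g S = g T \<Longrightarrow> f S = f T"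
  shows "finite (f ` X)"
proof -
  have "f S = (f \<circ> inv_into X g) (g S)" if "S \<in> X" for S
    unfolding o_def using that by (intro inv) (auto simp: inv_into_into f_inv_into_f)
  then have "f ` X \<subseteq> (f \<circ> inv_into X g) ` g ` X" by blast
  then show ?thesis using fin finite_surj by blast
qed

text \<open>
  The class at level \<open>k + 1\<close> is determined by the class at level \<open>k\<close> together with the finite set of
  classes at level \<open>k\<close> that are reached by placing one more mark.
\<close>

lemma finite_similarity_classes:
  fixes A :: "'c set"
  assumes V: "finite V" and A: "finite A"
  shows "finite ((\<lambda>(u, a). similarity_class C V k u a) ` marked_words V A)"
proof (induction k)
  case 0
  let ?Z = "{- int C..int C}"
  define one where
    "one u a = {(x, u ! p, clip C (int p), clip C (int (length u) - int p)) |x p. a x = Some p}"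
    for u :: "'c list" and a :: marks
  define two where
    "two a = {(x, y, clip C (int p' - int p)) |x y p p'. a x = Some p \<and> a y = Some p'}" for a :: marks
  define g where "g = (\<lambda>(u :: 'c list, a). (clip C (int (length u)), one u a, two a))"
  show ?case
  proof (rule finite_image_via_invariant)
    have "g (u, a) \<in> ?Z \<times> Pow (V \<times> A \<times> ?Z \<times> ?Z) \<times> Pow (V \<times> V \<times> ?Z)"
      if X: "(u, a) \<in> marked_words V A" for u a
    proof -
      have "x \<in> V" "u ! p \<in> A" if "a x = Some p" for x p
        using X that by (auto simp: marked_words_def well_marked_def in_lists_conv_set)
      then have "one u a \<subseteq> V \<times> A \<times> ?Z \<times> ?Z" "two a \<subseteq> V \<times> V \<times> ?Z"
        using clip_range [of C] unfolding one_def two_def by blast+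
      then show ?thesis
        using clip_range [of C] by (simp add: g_def)
    qed
    then have "g ` marked_words V A \<subseteq> ?Z \<times> Pow (V \<times> A \<times> ?Z \<times> ?Z) \<times> Pow (V \<times> V \<times> ?Z)"
      by (intro image_subsetI) (simp only: surj_pair split_paired_all)
    then show "finite (g ` marked_words V A)"
      by (rule finite_subset) (use V A in simp)
  next
    fix S T :: "'c list \<times> marks"
    assume "g S = g T"
    moreover obtain u a v b where ST: "S = (u, a)" "T = (v, b)" by (metis surj_pair)
    ultimately have len: "clip C (int (length u)) = clip C (int (length v))"
      and one: "one u a = one v b" and two: "two a = two b"
      by (simp_all add: g_def)
    have dom: "dom a = fst ` one u a" for u a
      by (force simp: one_def image_iff)
    have "same_atomic C u a v b"
      unfolding same_atomic_def
    proof (intro conjI allI impI)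
      show "dom a = dom b" by (simp only: dom [of a u] dom [of b v] one)
    next
      fix x p q assume x: "a x = Some p" "b x = Some q"
      have "(x, u ! p, clip C (int p), clip C (int (length u) - int p)) \<in> one u a"
        unfolding one_def using x by blast
      then have "(x, u ! p, clip C (int p), clip C (int (length u) - int p)) \<in> one v b"
        by (simp only: one)
      with x(2) show "u ! p = v ! q" "clip C (int p) = clip C (int q)"
          "clip C (int (length u) - int p) = clip C (int (length v) - int q)"
        by (auto simp: one_def)
    next
      fix x y p p' q q'
      assume xy: "a x = Some p" "a y = Some p'" "b x = Some q" "b y = Some q'"
      have "(x, y, clip C (int p' - int p)) \<in> two a"
        unfolding two_def using xy by blast
      then have "(x, y, clip C (int p' - int p)) \<in> two b"
        by (simp only: two)
      with xy show "clip C (int p' - int p) = clip C (int q' - int q)"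
        by (auto simp: two_def)
    qed (rule len)
    then show "(case S of (u, a) \<Rightarrow> similarity_class C V 0 u a) = (case T of (u, a) \<Rightarrow> similarity_class C V 0 u a)"
      by (simp add: ST similarity_class_eq_iff)
  qed
next
  case (Suc k)
  let ?X = "marked_words V A" and ?c = "\<lambda>u a. similarity_class C V k u a"
  let ?Y = "(\<lambda>(u, a). ?c u a) ` ?X"
  define ext where "ext u a = {(x, ?c u (a(x \<mapsto> p))) |x p. x \<in> V \<and> p < length u}" for u :: "'c list" and a
  define g where "g = (\<lambda>(u, a). (?c u a, ext u a))"
  show ?case
  proof (rule finite_image_via_invariant)
    have "g (u, a) \<in> ?Y \<times> Pow (V \<times> ?Y)" if X: "(u, a) \<in> ?X" for u a
    proof -
      have "?c u (a(x \<mapsto> p)) \<in> ?Y" if "x \<in> V" "p < length u" for x p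
        using X that
        by (intro image_eqI [of _ _ "(u, a(x \<mapsto> p))"]) (auto simp: marked_words_def well_marked_upd)
      then have "ext u a \<subseteq> V \<times> ?Y"
        unfolding ext_def by blast
      moreover have "?c u a \<in> ?Y"
        using X by (intro image_eqI [of _ _ "(u, a)"]) simp_all
      ultimately show ?thesis
        unfolding g_def split_conv by (intro SigmaI PowI)
    qed
    then have "g ` ?X \<subseteq> ?Y \<times> Pow (V \<times> ?Y)"
      by (intro image_subsetI) (simp only: surj_pair split_paired_all)
    then show "finite (g ` ?X)"
      by (rule finite_subset) (use V Suc in simp)
  next
    fix S T :: "'c list \<times> marks"
    assume "g S = g T"
    moreover obtain u a v b where ST: "S = (u, a)" "T = (v, b)" by (metis surj_pair)
    ultimately have c: "?c u a = ?c v b" and ext: "ext u a = ext v b"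
      by (simp_all add: g_def)
    have extD: "\<exists>q<length v. similar C V k u (a(x \<mapsto> p)) v (b(x \<mapsto> q))"
      if eq: "ext u a = ext v b" and x: "x \<in> V" "p < length u" for u v :: "'c list" and a b x p
    proof -
      have "(x, ?c u (a(x \<mapsto> p))) \<in> ext u a" unfolding ext_def using x by blast
      then have "(x, ?c u (a(x \<mapsto> p))) \<in> ext v b" by (simp only: eq)
      then obtain q where "q < length v" "?c u (a(x \<mapsto> p)) = ?c v (b(x \<mapsto> q))"
        unfolding ext_def by blast
      then show ?thesis by (auto simp: similarity_class_eq_iff)
    qed
    have "similar C V k u a v b"
      using c by (simp only: similarity_class_eq_iff)
    moreover have "\<exists>p<length u. similar C V k u (a(x \<mapsto> p)) v (b(x \<mapsto> q))"
      if "x \<in> V" "q < length v" for x q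
      using extD [OF ext [symmetric] that] similar_sym by blast
    ultimately have "similar C V (Suc k) u a v b"
      using extD [OF ext] by simp
    then show "(case S of (u, a) \<Rightarrow> similarity_class C V (Suc k) u a) =
        (case T of (u, a) \<Rightarrow> similarity_class C V (Suc k) u a)"
      by (simp only: ST split_conv similarity_class_eq_iff)
  qed
qed

lemma absorbing_similarity_word_exists:
  fixes A :: "'c set"
  assumes V: "finite V" and A: "finite A"
  shows "\<exists>e\<in>lists A. \<forall>x\<in>lists A. word_similar C V k (e @ x @ e) e"
proof (rule absorbing_word_exists)
  show "\<exists>m. word_similar C V k (word_power w m) (word_power w (Suc m))" for w :: "'c list"
    by (rule exI [of _ "(C + 1) * 2 ^ k"], rule word_similar_power) simp
  let ?f = "\<lambda>u :: 'c list. similarity_class C V k u Map.empty"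
  have "?f ` lists A \<subseteq> (\<lambda>(u, a). similarity_class C V k u a) ` marked_words V A"
  proof (rule image_subsetI)
    fix u :: "'c list" assume "u \<in> lists A"
    then show "?f u \<in> (\<lambda>(u, a). similarity_class C V k u a) ` marked_words V A"
      by (intro image_eqI [of _ _ "(u, Map.empty)"]) (auto simp: marked_words_def well_marked_empty)
  qed
  then have "finite (?f ` lists A)"
    using finite_similarity_classes [OF V A] by (rule finite_subset)
  then show "finite ((\<lambda>u. {v. word_similar C V k u v}) ` lists A)"
  proof (rule finite_image_via_invariant)
    fix u v :: "'c list"
    assume "?f u = ?f v"
    then have "word_similar C V k u v" by (simp only: similarity_class_eq_iff)
    then show "{w. word_similar C V k u w} = {w. word_similar C V k v w}"
      using similar_sym similar_trans by blast
  qed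
qed (blast intro: similar_refl similar_sym similar_trans word_similar_append)+

section \<open>First order sentences on circular words\<close>

text \<open>
  The letter at a position is the set of lengths \<open>d\<close> of the edges that leave it in clockwise
  direction. The second disjunct covers edges that pass the cut between the last and the first position.
\<close>

definition arc :: "nat \<Rightarrow> nat set list \<Rightarrow> nat \<Rightarrow> nat \<Rightarrow> bool" where
  "arc K w i j \<longleftrightarrow> (\<exists>d\<in>w ! i. 1 \<le> d \<and> d \<le> K \<and> (j = i + d \<or> j + length w = i + d))"

definition word_graph :: "nat \<Rightarrow> nat set list \<Rightarrow> nat set set" where
  "word_graph K w = {{Suc i, Suc j} |i j. i < length w \<and> j < length w \<and> arc K w i j}"

lemma word_graph_edge_iff:
  assumes "i < length w" "j < length w"
  shows "{Suc i, Suc j} \<in> word_graph K w \<longleftrightarrow> arc K w i j \<or> arc K w j i"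
  using assms by (auto simp: word_graph_def doubleton_eq_iff)

primrec quantifier_rank :: "fm \<Rightarrow> nat" where
  "quantifier_rank (Eq x y) = 0"
| "quantifier_rank (Adj x y) = 0"
| "quantifier_rank (Cyc x y z) = 0"
| "quantifier_rank (Neg \<phi>) = quantifier_rank \<phi>"
| "quantifier_rank (Conj \<phi> \<psi>) = max (quantifier_rank \<phi>) (quantifier_rank \<psi>)"
| "quantifier_rank (Exists x \<phi>) = Suc (quantifier_rank \<phi>)"

primrec bound_vars :: "fm \<Rightarrow> nat set" where
  "bound_vars (Eq x y) = {}"
| "bound_vars (Adj x y) = {}"
| "bound_vars (Cyc x y z) = {}"
| "bound_vars (Neg \<phi>) = bound_vars \<phi>"
| "bound_vars (Conj \<phi> \<psi>) = bound_vars \<phi> \<union> bound_vars \<psi>"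
| "bound_vars (Exists x \<phi>) = insert x (bound_vars \<phi>)"

lemma finite_bound_vars: "finite (bound_vars \<phi>)"
  by (induction \<phi>) auto

text \<open>
  Whether an edge passes the cut is seen from the distance of its start to the end of the word and the
  distance of its target from the beginning.
\<close>

lemma same_atomic_arc:
  assumes S: "same_atomic (Suc K) u a v b"
    and W: "well_marked u a" "well_marked v b"
    and x: "a x = Some p" "b x = Some q" and y: "a y = Some p'" "b y = Some q'"
  shows "arc K u p p' \<longleftrightarrow> arc K v q q'"
proof -
  have lt: "p < length u" "q < length v" using W x by (auto simp: well_marked_def)
  have "p' = p + d \<longleftrightarrow> q' = q + d" if "d \<le> K" for d
  proof -
    have "int p' - int p = int d \<longleftrightarrow> int q' - int q = int d"
      using same_atomicD(6) [OF S x(1) y(1) x(2) y(2)] by (rule clip_eq_iff) (use that in simp)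
    then show ?thesis by linarith
  qed
  moreover have "p' + length u = p + d \<longleftrightarrow> q' + length v = q + d" if "d \<le> K" for d
  proof -
    have "clip (Suc K) ((int (length u) - int p) + int p') = clip (Suc K) ((int (length v) - int q) + int q')"
      using same_atomicD(5) [OF S x] same_atomicD(4) [OF S y] lt by (intro clip_add) auto
    then have "(int (length u) - int p) + int p' = int d \<longleftrightarrow> (int (length v) - int q) + int q' = int d"
      by (rule clip_eq_iff) (use that in simp)
    then show ?thesis by linarith
  qed
  ultimately have "1 \<le> d \<and> d \<le> K \<and> (p' = p + d \<or> p' + length u = p + d) \<longleftrightarrow>
      1 \<le> d \<and> d \<le> K \<and> (q' = q + d \<or> q' + length v = q + d)" for d
    by blast
  then show ?thesis
    unfolding arc_def same_atomicD(3) [OF S x] by simp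
qed

text \<open>
  The usual induction for Ehrenfeucht-Fraisse games. The vertices are numbered from 1, positions in words
  from 0.
\<close>

lemma sat_similar:
  assumes "similar (Suc K) V k u a v b" "well_marked u a" "well_marked v b"
    and "quantifier_rank \<phi> \<le> k" "bound_vars \<phi> \<subseteq> V"
    and "\<And>x. x \<in> free_vars \<phi> \<Longrightarrow> \<exists>p q. a x = Some p \<and> b x = Some q \<and> s x = Suc p \<and> t x = Suc q"
  shows "sat (length u) (word_graph K u) s \<phi> \<longleftrightarrow> sat (length v) (word_graph K v) t \<phi>"
  using assms
proof (induction \<phi> arbitrary: k a b s t)
  case (Eq x y)
  note A = similar_same_atomic [OF Eq.prems(1)]
  obtain p q where x: "a x = Some p" "b x = Some q" "s x = Suc p" "t x = Suc q"
    using Eq.prems(6) [of x] by auto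
  obtain p' q' where y: "a y = Some p'" "b y = Some q'" "s y = Suc p'" "t y = Suc q'"
    using Eq.prems(6) [of y] by auto
  have "int p' - int p = 0 \<longleftrightarrow> int q' - int q = 0"
    using same_atomicD(6) [OF A x(1) y(1) x(2) y(2)] by (rule clip_eq_iff) simp
  then show ?case by (auto simp: x y)
next
  case (Adj x y)
  note A = similar_same_atomic [OF Adj.prems(1)]
  obtain p q where x: "a x = Some p" "b x = Some q" "s x = Suc p" "t x = Suc q"
    using Adj.prems(6) [of x] by auto
  obtain p' q' where y: "a y = Some p'" "b y = Some q'" "s y = Suc p'" "t y = Suc q'"
    using Adj.prems(6) [of y] by auto
  have "p < length u" "q < length v" "p' < length u" "q' < length v"
    using x y Adj.prems(2,3) by (auto simp: well_marked_def)
  then show ?case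
    using same_atomic_arc [OF A Adj.prems(2,3) x(1,2) y(1,2)]
      same_atomic_arc [OF A Adj.prems(2,3) y(1,2) x(1,2)]
    by (simp add: x y word_graph_edge_iff)
next
  case (Cyc x y z)
  note A = similar_same_atomic [OF Cyc.prems(1)]
  obtain p q where x: "a x = Some p" "b x = Some q" "s x = Suc p" "t x = Suc q"
    using Cyc.prems(6) [of x] by auto
  obtain p' q' where y: "a y = Some p'" "b y = Some q'" "s y = Suc p'" "t y = Suc q'"
    using Cyc.prems(6) [of y] by auto
  obtain p'' q'' where z: "a z = Some p''" "b z = Some q''" "s z = Suc p''" "t z = Suc q''"
    using Cyc.prems(6) [of z] by auto
  have le: "p' \<le> p \<longleftrightarrow> q' \<le> q"
    if "a x = Some p" "b x = Some q" "a y = Some p'" "b y = Some q'" for x y p q p' q'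
  proof -
    have "int p' - int p \<le> 0 \<longleftrightarrow> int q' - int q \<le> 0"
      using same_atomicD(6) [OF A that(1,3,2,4)] by (rule clip_le_iff) simp
    then show ?thesis by simp
  qed
  show ?case
    using le [OF x(1,2) y(1,2)] le [OF y(1,2) x(1,2)] le [OF y(1,2) z(1,2)] le [OF z(1,2) y(1,2)]
      le [OF x(1,2) z(1,2)] le [OF z(1,2) x(1,2)]
    by (simp add: clockwise_def x y z)
next
  case (Neg \<phi>)
  then show ?case by simp
next
  case (Conj \<phi> \<psi>)
  have "sat (length u) (word_graph K u) s \<phi> \<longleftrightarrow> sat (length v) (word_graph K v) t \<phi>"
    by (rule Conj.IH(1) [OF Conj.prems(1-3)]) (use Conj.prems(4-6) in auto)
  moreover have "sat (length u) (word_graph K u) s \<psi> \<longleftrightarrow> sat (length v) (word_graph K v) t \<psi>"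
    by (rule Conj.IH(2) [OF Conj.prems(1-3)]) (use Conj.prems(4-6) in auto)
  ultimately show ?case by simp
next
  case (Exists x \<phi>)
  obtain k' where k: "k = Suc k'" using Exists.prems(4) by (cases k) auto
  note S = Exists.prems(1) [unfolded k]
  have x: "x \<in> V" using Exists.prems(5) by simp
  have IH: "sat (length u) (word_graph K u) (s(x := Suc p)) \<phi> \<longleftrightarrow>
      sat (length v) (word_graph K v) (t(x := Suc q)) \<phi>"
    if "similar (Suc K) V k' u (a(x \<mapsto> p)) v (b(x \<mapsto> q))" "p < length u" "q < length v" for p q
  proof (rule Exists.IH [OF that(1)])
    show "well_marked u (a(x \<mapsto> p))" "well_marked v (b(x \<mapsto> q))"
      using Exists.prems(2,3) that(2,3) by (simp_all only: well_marked_upd)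
  qed (use Exists.prems(4-6) k in auto)
  have Suc_ex: "(\<exists>n\<in>{1..m}. P n) \<longleftrightarrow> (\<exists>p<m. P (Suc p))" for m P
    unfolding image_Suc_lessThan [symmetric] by blast
  show ?case
    unfolding sat.simps Suc_ex
    using similar_SucD(2) [OF S x] similar_SucD(3) [OF S x] IH by blast
qed

text \<open>
  The effect on the vertices of replacing the word \<open>u @ v\<close> by \<open>v @ u\<close>, where \<open>l\<close> and \<open>m\<close> are the lengths
  of \<open>u\<close> and \<open>v\<close>. Both words describe the same circular structure, cut at different places.
\<close>

definition rotate_vertex :: "nat \<Rightarrow> nat \<Rightarrow> nat \<Rightarrow> nat" where
  "rotate_vertex l m i = (if i \<le> l then i + m else i - l)"

lemma clockwise_rotate:
  assumes "x \<in> {1..l + m}" "y \<in> {1..l + m}" "z \<in> {1..l + m}"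
  shows "clockwise (rotate_vertex l m x) (rotate_vertex l m y) (rotate_vertex l m z) \<longleftrightarrow> clockwise x y z"
  using assms unfolding clockwise_def rotate_vertex_def by auto

lemma rotate_vertex_in: "x \<in> {1..l + m} \<Longrightarrow> rotate_vertex l m x \<in> {1..l + m}"
  by (auto simp: rotate_vertex_def)

lemma rotate_vertex_inverse: "x \<in> {1..l + m} \<Longrightarrow> rotate_vertex l m (rotate_vertex m l x) = x"
  by (auto simp: rotate_vertex_def)

lemma arc_rotate:
  assumes "i < length (u @ v)" "j < length (u @ v)" "K < length (u @ v)"
    and "Suc i' = rotate_vertex (length u) (length v) (Suc i)"
    and "Suc j' = rotate_vertex (length u) (length v) (Suc j)"
  shows "arc K (v @ u) i' j' \<longleftrightarrow> arc K (u @ v) i j"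
proof -
  have i': "i' = (if i < length u then i + length v else i - length u)"
    and j': "j' = (if j < length u then j + length v else j - length u)"
    using assms(4,5) by (auto simp: rotate_vertex_def split: if_splits)
  have "(v @ u) ! i' = (u @ v) ! i"
    using assms(1) by (auto simp: i' nth_append)
  moreover have "j' = i' + d \<or> j' + length (v @ u) = i' + d \<longleftrightarrow> j = i + d \<or> j + length (u @ v) = i + d"
    if "1 \<le> d" "d \<le> K" for d
    using that assms(1-3) unfolding i' j' length_append by (cases "i < length u"; cases "j < length u"; simp; linarith)
  ultimately show ?thesis
    unfolding arc_def by blast
qed

lemma sat_rotate:
  fixes u v :: "nat set list"
  assumes K: "K < length (u @ v)" and "\<And>x. s x \<in> {1..length (u @ v)}"
  shows "sat (length (u @ v)) (word_graph K (v @ u)) (\<lambda>x. rotate_vertex (length u) (length v) (s x)) \<phi> \<longleftrightarrow>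
    sat (length (u @ v)) (word_graph K (u @ v)) s \<phi>"
proof -
  define n where "n = length (u @ v)"
  define r where "r = rotate_vertex (length u) (length v)"
  define r' where "r' = rotate_vertex (length v) (length u)"
  have inverse: "r' (r m) = m" "r (r' m) = m" and into: "r m \<in> {1..n}" "r' m \<in> {1..n}"
    if "m \<in> {1..n}" for m
    using that rotate_vertex_inverse [of m "length v" "length u"] rotate_vertex_inverse [of m "length u" "length v"]
      rotate_vertex_in [of m "length u" "length v"] rotate_vertex_in [of m "length v" "length u"]
    by (simp_all add: n_def r_def r'_def add.commute)
  have edge: "{r x, r y} \<in> word_graph K (v @ u) \<longleftrightarrow> {x, y} \<in> word_graph K (u @ v)"
    if xy: "x \<in> {1..n}" "y \<in> {1..n}" for x y
  proof -
    obtain i j where ij: "x = Suc i" "i < length (u @ v)" "y = Suc j" "j < length (u @ v)"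
      using xy unfolding image_Suc_lessThan [symmetric] n_def by blast
    obtain i' j' where ij': "r x = Suc i'" "i' < length (v @ u)" "r y = Suc j'" "j' < length (v @ u)"
      using into(1) [OF xy(1)] into(1) [OF xy(2)]
      unfolding image_Suc_lessThan [symmetric] n_def length_append add.commute [of "length v"] by blast
    have "arc K (v @ u) i' j' \<longleftrightarrow> arc K (u @ v) i j"
      by (rule arc_rotate [OF ij(2,4) K]) (simp_all only: r_def [symmetric] ij(1,3) [symmetric] ij'(1,3))
    moreover have "arc K (v @ u) j' i' \<longleftrightarrow> arc K (u @ v) j i"
      by (rule arc_rotate [OF ij(4,2) K]) (simp_all only: r_def [symmetric] ij(1,3) [symmetric] ij'(1,3))
    ultimately show ?thesis
      unfolding ij'(1,3) word_graph_edge_iff [OF ij'(2,4)] unfolding ij(1,3) word_graph_edge_iff [OF ij(2,4)]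
      by blast
  qed
  have "sat n (word_graph K (v @ u)) (\<lambda>x. r (s x)) \<phi> \<longleftrightarrow> sat n (word_graph K (u @ v)) s \<phi>"
    if "\<And>x. s x \<in> {1..n}" for s
    using that
  proof (induction \<phi> arbitrary: s)
    case (Eq x y)
    show ?case
      using inverse(1) [OF Eq [of x]] inverse(1) [OF Eq [of y]] unfolding sat.simps by metis
  next
    case (Adj x y)
    show ?case
      unfolding sat.simps by (rule edge [OF Adj Adj])
  next
    case (Cyc x y z)
    show ?case
      unfolding sat.simps r_def
      by (rule clockwise_rotate; rule Cyc [unfolded n_def length_append])
  next
    case (Neg \<phi>)
    show ?case
      unfolding sat.simps Neg.IH [OF Neg.prems] ..
  next
    case (Conj \<phi> \<psi>)
    show ?case
      unfolding sat.simps Conj.IH(1) [OF Conj.prems] Conj.IH(2) [OF Conj.prems] ..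
  next
    case (Exists x \<phi>)
    have IH: "sat n (word_graph K (v @ u)) ((\<lambda>x. r (s x))(x := r m)) \<phi> \<longleftrightarrow>
        sat n (word_graph K (u @ v)) (s(x := m)) \<phi>" if "m \<in> {1..n}" for m
    proof -
      have "(\<lambda>x. r (s x))(x := r m) = (\<lambda>y. r ((s(x := m)) y))" by (rule ext) simp
      moreover have "(s(x := m)) y \<in> {1..n}" for y
        using Exists.prems [of y] that by (simp add: fun_upd_apply)
      ultimately show ?thesis
        using Exists.IH [of "s(x := m)"] by (simp only:)
    qed
    show ?case
      unfolding sat.simps
    proof
      assume "\<exists>m\<in>{1..n}. sat n (word_graph K (v @ u)) ((\<lambda>x. r (s x))(x := m)) \<phi>"
      then obtain m where m: "m \<in> {1..n}" "sat n (word_graph K (v @ u)) ((\<lambda>x. r (s x))(x := m)) \<phi>"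
        by blast
      then have "sat n (word_graph K (v @ u)) ((\<lambda>x. r (s x))(x := r (r' m))) \<phi>"
        by (simp only: inverse(2))
      then show "\<exists>m\<in>{1..n}. sat n (word_graph K (u @ v)) (s(x := m)) \<phi>"
        using IH into(2) m(1) by blast
    next
      assume "\<exists>m\<in>{1..n}. sat n (word_graph K (u @ v)) (s(x := m)) \<phi>"
      then show "\<exists>m\<in>{1..n}. sat n (word_graph K (v @ u)) ((\<lambda>x. r (s x))(x := m)) \<phi>"
        using IH into(1) by blast
    qed
  qed
  then show ?thesis
    using assms(2) unfolding n_def r_def by blast
qed

definition holds_on_circle :: "nat \<Rightarrow> fm \<Rightarrow> nat set list \<Rightarrow> bool" where
  "holds_on_circle K \<psi> w \<longleftrightarrow> models (length w) (word_graph K w) \<psi>"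

lemma holds_on_circle_similar:
  assumes "is_sentence \<psi>" "word_similar (Suc K) (bound_vars \<psi>) (quantifier_rank \<psi>) u v"
  shows "holds_on_circle K \<psi> u \<longleftrightarrow> holds_on_circle K \<psi> v"
  unfolding holds_on_circle_def models_iff_sat [OF assms(1), where s = "\<lambda>_. 0"]
  using assms by (intro sat_similar) (auto simp: is_sentence_def well_marked_empty)

lemma holds_on_circle_rotate:
  assumes "is_sentence \<psi>" "K < length (u @ v)"
  shows "holds_on_circle K \<psi> (v @ u) \<longleftrightarrow> holds_on_circle K \<psi> (u @ v)"
proof -
  let ?s = "\<lambda>_ :: nat. 1 :: nat"
  have "models (length (v @ u)) (word_graph K (v @ u)) \<psi> \<longleftrightarrow>
      sat (length (u @ v)) (word_graph K (v @ u)) (\<lambda>x. rotate_vertex (length u) (length v) (?s x)) \<psi>"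
    by (subst models_iff_sat [OF assms(1)]) (simp add: add.commute)
  also have "\<dots> \<longleftrightarrow> sat (length (u @ v)) (word_graph K (u @ v)) ?s \<psi>"
    using assms(2) by (intro sat_rotate) auto
  finally show ?thesis
    unfolding holds_on_circle_def models_iff_sat [OF assms(1), where s = ?s] .
qed

text \<open>
  Every circle that contains \<open>e\<close> satisfies the same sentences of the rank of \<open>\<psi>\<close> as \<open>e\<close> itself: rotate
  \<open>x e y\<close> to \<open>e y x\<close>, double \<open>e\<close>, rotate to \<open>e y x e\<close> and absorb \<open>y x\<close>.
\<close>

lemma decisive_word_exists:
  assumes \<psi>: "is_sentence \<psi>" and A: "finite A" "A \<noteq> {}"
  shows "\<exists>e\<in>lists A. e \<noteq> [] \<and> (\<forall>x\<in>lists A. \<forall>y\<in>lists A.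
    holds_on_circle K \<psi> (x @ e @ y) \<longleftrightarrow> holds_on_circle K \<psi> e)"
proof -
  let ?sim = "word_similar (Suc K) (bound_vars \<psi>) (quantifier_rank \<psi>) :: nat set list \<Rightarrow> _"
  obtain e where e: "e \<in> lists A" and absorb: "\<And>x. x \<in> lists A \<Longrightarrow> ?sim (e @ x @ e) e"
    using absorbing_similarity_word_exists [OF finite_bound_vars A(1)] by blast
  \<comment> \<open>Absorbing a word of length \<open>K + 1\<close> leaves the clipped length unchanged, so \<open>e\<close> is at least as long.\<close>
  have len: "K < length e"
  proof -
    obtain c where "c \<in> A" using A(2) by blast
    then have "?sim (e @ replicate (Suc K) c @ e) e" by (intro absorb) auto
    then have "clip (Suc K) (int (length (e @ replicate (Suc K) c @ e))) = clip (Suc K) (int (length e))"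
      using similar_same_atomic same_atomicD(2) by blast
    then show ?thesis by (auto simp: clip_eq_clip_iff)
  qed
  have "holds_on_circle K \<psi> (x @ e @ y) \<longleftrightarrow> holds_on_circle K \<psi> e"
    if x: "x \<in> lists A" and y: "y \<in> lists A" for x y
  proof -
    have "?sim (e @ e) e" using absorb [of "[]"] by simp
    then have ee: "?sim ((e @ e) @ y @ x) (e @ y @ x)"
      by (rule word_similar_append) (rule similar_refl)
    have "holds_on_circle K \<psi> (x @ e @ y) \<longleftrightarrow> holds_on_circle K \<psi> ((e @ y) @ x)"
      using len by (intro holds_on_circle_rotate \<psi>) simp
    also have "\<dots> \<longleftrightarrow> holds_on_circle K \<psi> (e @ e @ y @ x)"
      using holds_on_circle_similar [OF \<psi> ee] by simp
    also have "\<dots> \<longleftrightarrow> holds_on_circle K \<psi> ((e @ y @ x) @ e)"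
      using len by (intro holds_on_circle_rotate \<psi>) simp
    also have "\<dots> \<longleftrightarrow> holds_on_circle K \<psi> e"
      using absorb [of "y @ x"] x y by (intro holds_on_circle_similar \<psi>) simp
    finally show ?thesis .
  qed
  moreover have "e \<noteq> []" using len by auto
  ultimately show ?thesis using e by blast
qed

section \<open>The zero-one law for finite support\<close>

text \<open>
  The bit that decides whether \<open>d\<close> belongs to the letter at position \<open>i\<close>. Bits are indexed by increasing
  pairs, so an edge that passes the cut is listed with its target first.
\<close>

definition arc_pair :: "nat \<Rightarrow> nat \<Rightarrow> nat \<Rightarrow> nat \<times> nat" where
  "arc_pair n i d = (if i + d < n then (Suc i, Suc (i + d)) else (Suc (i + d - n), Suc i))"

lemma arc_pair_distance:
  assumes "i < n" "1 \<le> d" "2 * d < n" "arc_pair n i d = (v, w)"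
  shows "(v, w) \<in> vertex_pairs n" "w - v < n" "min (w - v) (n - (w - v)) = d"
  using assms by (auto simp: arc_pair_def vertex_pairs_def split: if_splits)

definition word_of_bits :: "nat \<Rightarrow> nat \<Rightarrow> (nat \<times> nat \<Rightarrow> bool) \<Rightarrow> nat set list" where
  "word_of_bits n K b = map (\<lambda>i. {d \<in> {1..K}. b (arc_pair n i d)}) [0..<n]"

lemma length_word_of_bits [simp]: "length (word_of_bits n K b) = n"
  by (simp add: word_of_bits_def)

lemma nth_word_of_bits: "i < n \<Longrightarrow> word_of_bits n K b ! i = {d \<in> {1..K}. b (arc_pair n i d)}"
  by (simp add: word_of_bits_def)

lemma word_graph_of_bits:
  assumes b: "b \<in> set_pmf (bits_pmf n p)" and n: "2 * K < n"
    and p01: "\<And>i. i \<ge> 1 \<Longrightarrow> 0 \<le> p i \<and> p i \<le> 1" and pK: "\<And>d. K < d \<Longrightarrow> p d = 0"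
  shows "word_graph K (word_of_bits n K b) = graph_of_bits n b"
proof (intro set_eqI iffI)
  fix E assume "E \<in> word_graph K (word_of_bits n K b)"
  then obtain i j where E: "E = {Suc i, Suc j}" "i < n" "j < n" "arc K (word_of_bits n K b) i j"
    unfolding word_graph_def length_word_of_bits by blast
  obtain d where d: "1 \<le> d" "d \<le> K" "b (arc_pair n i d)" "j = i + d \<or> j + n = i + d"
    using E(4) unfolding arc_def nth_word_of_bits [OF E(2)] length_word_of_bits by blast
  obtain v w where vw: "arc_pair n i d = (v, w)" by fastforce
  then have "E = {v, w}"
    using E d by (auto simp: arc_pair_def split: if_splits)
  moreover have "(v, w) \<in> vertex_pairs n"
    using arc_pair_distance(1) [OF E(2) d(1) _ vw] d(2) n by simp
  ultimately show "E \<in> graph_of_bits n b"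
    using d(3) vw by (auto simp: graph_of_bits_def)
next
  fix E assume "E \<in> graph_of_bits n b"
  then obtain v w where E: "E = {v, w}" and vw: "(v, w) \<in> vertex_pairs n" "b (v, w)"
    by (auto simp: graph_of_bits_def)
  define d where "d = min (w - v) (n - (w - v))"
  have V: "1 \<le> v" "v < w" "w \<le> n" using vw(1) by (auto simp: vertex_pairs_def)
  have "p d \<noteq> 0"
    unfolding d_def by (rule bits_pmf_support(1) [OF b vw(1) p01 _ vw(2)]) (use V in auto)
  then have d: "1 \<le> d" "d \<le> K"
    using pK [of d] V by (auto simp: d_def not_less [symmetric])
  obtain i j where ij: "i < n" "j < n" "E = {Suc i, Suc j}" "arc_pair n i d = (v, w)"
    "j = i + d \<or> j + n = i + d"
  proof (cases "w - v \<le> n - (w - v)")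
    case True
    then show ?thesis
      using V E by (intro that [of "v - 1" "w - 1"]) (auto simp: d_def arc_pair_def)
  next
    case False
    then show ?thesis
      using V E by (intro that [of "w - 1" "v - 1"]) (auto simp: d_def arc_pair_def)
  qed
  then have "arc K (word_of_bits n K b) i j"
    using d vw(2) unfolding arc_def by (auto simp: nth_word_of_bits intro!: bexI [of _ d])
  then show "E \<in> word_graph K (word_of_bits n K b)"
    using ij by (auto simp: word_graph_def)
qed

text \<open>
  The letters of positive probability. Only words over these letters have a positive probability of
  occurring, and only these have to be absorbed.
\<close>

definition possible_letters :: "nat \<Rightarrow> (nat \<Rightarrow> real) \<Rightarrow> nat set set" where
  "possible_letters K p = {X. {d \<in> {1..K}. p d = 1} \<subseteq> X \<and> X \<subseteq> {d \<in> {1..K}. p d \<noteq> 0}}"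

lemma finite_possible_letters: "finite (possible_letters K p)"
  by (rule finite_subset [of _ "Pow {1..K}"]) (auto simp: possible_letters_def)

lemma possible_letters_nonempty: "possible_letters K p \<noteq> {}"
proof -
  have "{d \<in> {1..K}. p d = 1} \<in> possible_letters K p" by (auto simp: possible_letters_def)
  then show ?thesis by blast
qed

lemma word_of_bits_possible:
  assumes b: "b \<in> set_pmf (bits_pmf n p)" and n: "2 * K < n"
    and p01: "\<And>i. i \<ge> 1 \<Longrightarrow> 0 \<le> p i \<and> p i \<le> 1"
  shows "word_of_bits n K b \<in> lists (possible_letters K p)"
proof -
  have "(b (arc_pair n i d) \<longrightarrow> p d \<noteq> 0) \<and> (\<not> b (arc_pair n i d) \<longrightarrow> p d \<noteq> 1)"
    if "i < n" "1 \<le> d" "d \<le> K" for i d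
  proof -
    obtain v w where vw: "arc_pair n i d = (v, w)" by fastforce
    have *: "(v, w) \<in> vertex_pairs n" "w - v < n" "min (w - v) (n - (w - v)) = d"
      using arc_pair_distance [OF _ _ _ vw] that n by simp_all
    show ?thesis
      using bits_pmf_support [OF b *(1) p01 *(2)] unfolding *(3) vw by blast
  qed
  then have "{d \<in> {1..K}. b (arc_pair n i d)} \<in> possible_letters K p" if "i < n" for i
    using that unfolding possible_letters_def by auto
  then show ?thesis
    by (auto simp: word_of_bits_def)
qed

text \<open>
  A common lower bound for the probabilities of all outcomes of a single bit that can occur at all.
\<close>

lemma uniform_positive_bound:
  fixes p :: "nat \<Rightarrow> real"
  assumes "\<And>i. i \<ge> 1 \<Longrightarrow> 0 \<le> p i \<and> p i \<le> 1"
  obtains \<delta> where "0 < \<delta>" "\<delta> \<le> 1" "\<And>d. d \<in> {1..K} \<Longrightarrow> p d \<noteq> 0 \<Longrightarrow> \<delta> \<le> p d"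
    "\<And>d. d \<in> {1..K} \<Longrightarrow> p d \<noteq> 1 \<Longrightarrow> \<delta> \<le> 1 - p d"
proof
  let ?F = "insert 1 {x \<in> p ` {1..K} \<union> (\<lambda>d. 1 - p d) ` {1..K}. 0 < x}"
  have fin: "finite ?F" by simp
  show "0 < Min ?F" using Min_in [OF fin] by auto
  show "Min ?F \<le> 1" by (rule Min_le [OF fin]) simp
  show "Min ?F \<le> p d" if "d \<in> {1..K}" "p d \<noteq> 0" for d
    by (rule Min_le [OF fin]) (use that assms [of d] in auto)
  show "Min ?F \<le> 1 - p d" if "d \<in> {1..K}" "p d \<noteq> 1" for d
    by (rule Min_le [OF fin]) (use that assms [of d] in auto)
qed

text \<open>
  Cut \<open>J * length e\<close> positions into \<open>J\<close> consecutive blocks. The letters of a block are determined by the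
  bits of edges that start in the block, and the \<open>K\<close> positions after the last block keep these edges
  from passing the cut; so different blocks depend on disjoint sets of bits.
\<close>

lemma factor_occurs_with_high_probability:
  assumes p01: "\<And>i. i \<ge> 1 \<Longrightarrow> 0 \<le> p i \<and> p i \<le> 1"
    and e: "e \<in> lists (possible_letters K p)" "e \<noteq> []"
  shows "\<exists>q. 0 \<le> q \<and> q < 1 \<and> (\<forall>J n. 2 * K < n \<longrightarrow> J * length e + K \<le> n \<longrightarrow>
    measure_pmf.prob (bits_pmf n p) {b. \<nexists>x y. word_of_bits n K b = x @ e @ y} \<le> q ^ J)"
proof -
  define L where "L = length e"
  have L: "L > 0" using e by (simp add: L_def)
  obtain \<delta> where \<delta>: "0 < \<delta>" "\<delta> \<le> 1" and \<delta>0: "\<And>d. d \<in> {1..K} \<Longrightarrow> p d \<noteq> 0 \<Longrightarrow> \<delta> \<le> p d"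
    and \<delta>1: "\<And>d. d \<in> {1..K} \<Longrightarrow> p d \<noteq> 1 \<Longrightarrow> \<delta> \<le> 1 - p d"
    by (rule uniform_positive_bound [of p K, OF p01]) (assumption, rule that)
  have letters: "e ! i \<in> possible_letters K p" if "i < L" for i
    using e that by (auto simp: L_def in_lists_conv_set)
  have bound: "measure_pmf.prob (bits_pmf n p) {b. \<nexists>x y. word_of_bits n K b = x @ e @ y} \<le> (1 - \<delta> ^ (L * K)) ^ J"
    if n: "2 * K < n" "J * L + K \<le> n" for J n
  proof -
    define S where "S j = (\<lambda>(i, d). (Suc (j * L + i), Suc (j * L + i + d))) ` ({..<L} \<times> {1..K})" for j
    \<comment> \<open>The blocks are disjoint, so one pattern on all pairs can demand a copy of \<open>e\<close> in every block.\<close>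
    define g where "g = (\<lambda>(v, w). w - v \<in> e ! ((v - 1) mod L))"
    have fits: "j * L + i + d < n" if "j < J" "i < L" "d \<le> K" for i j d
    proof -
      have "Suc j * L \<le> J * L" using that by (intro mult_le_mono1) simp
      then show ?thesis using that n by simp
    qed
    have pair: "arc_pair n (j * L + i) d = (Suc (j * L + i), Suc (j * L + i + d))"
      if "j < J" "i < L" "d \<le> K" for i j d
      using fits [OF that] by (simp add: arc_pair_def)
    have occurs: "\<exists>x y. word_of_bits n K b = x @ e @ y" if j: "j < J" and agree: "\<forall>i\<in>S j. b i = g i" for b j
    proof -
      let ?w = "word_of_bits n K b"
      have "j * L + L \<le> n"
        using fits [of j "L - 1" 0] j L by simp
      have "take L (drop (j * L) ?w) = e"
      proof (rule nth_equalityI)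
        show len: "length (take L (drop (j * L) ?w)) = length e"
          using \<open>j * L + L \<le> n\<close> by (simp add: L_def)
        fix i assume "i < length (take L (drop (j * L) ?w))"
        then have i: "i < L" by simp
        have "b (Suc (j * L + i), Suc (j * L + i + d)) \<longleftrightarrow> d \<in> e ! i" if "d \<in> {1..K}" for d
        proof -
          have "(Suc (j * L + i), Suc (j * L + i + d)) \<in> S j"
            unfolding S_def using i that by force
          then show ?thesis using agree i by (simp add: g_def)
        qed
        then have "{d \<in> {1..K}. b (arc_pair n (j * L + i) d)} = e ! i"
          using letters [OF i] pair [OF j i] by (auto simp: possible_letters_def)
        then show "take L (drop (j * L) ?w) ! i = e ! i"
          using i \<open>j * L + L \<le> n\<close> by (simp add: nth_word_of_bits)
      qed
      then have "?w = take (j * L) ?w @ e @ drop L (drop (j * L) ?w)"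
        by (metis append_take_drop_id)
      then show ?thesis by blast
    qed
    have "measure_pmf.prob (bits_pmf n p) {b. \<nexists>x y. word_of_bits n K b = x @ e @ y} \<le>
        measure_pmf.prob (bits_pmf n p) {b. \<forall>j<J. \<exists>i\<in>S j. b i \<noteq> g i}"
      using occurs by (intro prob_le_on_support) blast
    also have "\<dots> \<le> (1 - \<delta> ^ (L * K)) ^ J"
    proof (rule prob_miss_all_cylinders)
      show "S j \<subseteq> vertex_pairs n" if "j < J" for j
        using fits [OF that] by (auto simp: S_def vertex_pairs_def Suc_le_eq)
      have block: "(fst c - 1) div L = j" if "c \<in> S j" for c j
        using that L by (auto simp: S_def)
      show "disjoint_family_on S {..<J}"
        unfolding disjoint_family_on_def by (metis block disjoint_iff)
      show "card (S j) \<le> L * K" for j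
        unfolding S_def by (rule order_trans [OF card_image_le]) simp_all
      show "\<delta> \<le> pmf (pair_distance_pmf n p c) (g c)" if "j < J" and c: "c \<in> S j" for j c
      proof -
        obtain i d where i: "i < L" and d: "d \<in> {1..K}" and c: "c = (Suc (j * L + i), Suc (j * L + i + d))"
          using c by (auto simp: S_def)
        have "min d (n - d) = d" using d n by auto
        then have "pmf (pair_distance_pmf n p c) (g c) = (if d \<in> e ! i then p d else 1 - p d)"
          using p01 [of d] d i by (simp add: c pair_distance_pmf_def g_def)
        also have "\<dots> \<ge> \<delta>"
          using letters [OF i] \<delta>0 [OF d] \<delta>1 [OF d] d by (auto simp: possible_letters_def)
        finally show ?thesis .
      qed
    qed (use \<delta> finite_vertex_pairs in auto)
    finally show ?thesis .
  qed
  have "0 < \<delta> ^ (L * K)" "\<delta> ^ (L * K) \<le> 1"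
    using \<delta> by (auto simp: power_le_one)
  then show ?thesis
    using bound by (intro exI [of _ "1 - \<delta> ^ (L * K)"]) (auto simp: L_def)
qed

theorem zero_one_law_of_finite_support:
  assumes p01: "\<And>i. i \<ge> 1 \<Longrightarrow> 0 \<le> p i \<and> p i \<le> 1" and fin: "finite {i. i \<ge> 1 \<and> p i \<noteq> 0}"
    and \<psi>: "is_sentence \<psi>"
  shows "(\<lambda>n. sat_prob n p \<psi>) \<longlonglongrightarrow> 0 \<or> (\<lambda>n. sat_prob n p \<psi>) \<longlonglongrightarrow> 1"
proof -
  obtain K where K: "\<And>d. d \<in> {i. i \<ge> 1 \<and> p i \<noteq> 0} \<Longrightarrow> d \<le> K"
    using fin unfolding finite_nat_set_iff_bounded_le by blast
  then have pK: "p d = 0" if "K < d" for d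
    using K [of d] that by fastforce
  let ?A = "possible_letters K p"
  obtain e where e: "e \<in> lists ?A" "e \<noteq> []"
    and decisive: "\<And>x y. x \<in> lists ?A \<Longrightarrow> y \<in> lists ?A \<Longrightarrow>
      holds_on_circle K \<psi> (x @ e @ y) \<longleftrightarrow> holds_on_circle K \<psi> e"
    using decisive_word_exists [OF \<psi> finite_possible_letters [of K p] possible_letters_nonempty [of K p], of K]
    by (elim bexE conjE) (rule that, assumption+, simp)
  have "\<exists>q. 0 \<le> q \<and> q < 1 \<and> (\<forall>J n. 2 * K < n \<longrightarrow> J * length e + K \<le> n \<longrightarrow>
      measure_pmf.prob (bits_pmf n p) {b. \<nexists>x y. word_of_bits n K b = x @ e @ y} \<le> q ^ J)"
    by (rule factor_occurs_with_high_probability [OF _ e]) (rule p01)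
  then obtain q where q: "0 \<le> q" "q < 1" and qJ: "\<And>J n. 2 * K < n \<Longrightarrow> J * length e + K \<le> n \<Longrightarrow>
      measure_pmf.prob (bits_pmf n p) {b. \<nexists>x y. word_of_bits n K b = x @ e @ y} \<le> q ^ J"
    by (elim exE conjE) (rule that, assumption+, simp)
  define c :: real where "c = (if holds_on_circle K \<psi> e then 1 else 0)"
  have close: "\<bar>sat_prob n p \<psi> - c\<bar> \<le> q ^ J" if n: "2 * K < n" "J * length e + K \<le> n" for n J
  proof -
    let ?M = "bits_pmf n p" and ?X = "{b. models n (graph_of_bits n b) \<psi>}"
    let ?miss = "{b. \<nexists>x y. word_of_bits n K b = x @ e @ y}"
    have truth: "b \<in> ?X \<longleftrightarrow> holds_on_circle K \<psi> e" if b: "b \<in> set_pmf ?M" "b \<notin> ?miss" for b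
    proof -
      obtain x y where xy: "word_of_bits n K b = x @ e @ y" using b(2) by blast
      have "x \<in> lists ?A" "y \<in> lists ?A"
        using word_of_bits_possible [OF b(1) n(1) p01] unfolding xy by simp_all
      then have "holds_on_circle K \<psi> (word_of_bits n K b) \<longleftrightarrow> holds_on_circle K \<psi> e"
        unfolding xy by (rule decisive)
      moreover have "word_graph K (word_of_bits n K b) = graph_of_bits n b"
        by (rule word_graph_of_bits [OF b(1) n(1)]) (use p01 pK in auto)
      ultimately show ?thesis
        by (simp add: holds_on_circle_def [of K \<psi> "word_of_bits n K b"])
    qed
    show ?thesis
    proof (cases "holds_on_circle K \<psi> e")
      case True
      have "measure_pmf.prob ?M (- ?X) \<le> measure_pmf.prob ?M ?miss"
        using truth True by (intro prob_le_on_support) blast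
      moreover have "measure_pmf.prob ?M (- ?X) = 1 - measure_pmf.prob ?M ?X"
        using measure_pmf.prob_compl [of ?X ?M] by (simp add: Compl_eq_Diff_UNIV)
      moreover have "measure_pmf.prob ?M ?X \<le> 1" by simp
      ultimately show ?thesis
        using qJ [OF n] True unfolding c_def sat_prob_bits by simp
    next
      case False
      have "measure_pmf.prob ?M ?X \<le> measure_pmf.prob ?M ?miss"
        using truth False by (intro prob_le_on_support) blast
      then show ?thesis
        using qJ [OF n] False unfolding c_def sat_prob_bits by simp
    qed
  qed
  have "(\<lambda>n. sat_prob n p \<psi>) \<longlonglongrightarrow> c"
  proof (rule LIMSEQ_I)
    fix \<epsilon> :: real assume "0 < \<epsilon>"
    then obtain J where "q ^ J < \<epsilon>" using real_arch_pow_inv [of \<epsilon> q] q by blast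
    then have "norm (sat_prob n p \<psi> - c) < \<epsilon>" if "n \<ge> 2 * K + 1 + J * length e" for n
      using close [of n J] that by simp
    then show "\<exists>N. \<forall>n\<ge>N. norm (sat_prob n p \<psi> - c) < \<epsilon>" by blast
  qed
  then show ?thesis by (auto simp: c_def split: if_splits)
qed

theorem theorem6:
  shows
    "(\<forall>p :: nat \<Rightarrow> real.
        (\<forall>i\<ge>1. 0 \<le> p i \<and> p i \<le> 1) \<and> finite {i. i \<ge> 1 \<and> p i \<noteq> 0} \<longrightarrow>
        (\<forall>\<psi>. is_sentence \<psi> \<longrightarrow>
           (\<lambda>n. sat_prob n p \<psi>) \<longlonglongrightarrow> 0 \<or> (\<lambda>n. sat_prob n p \<psi>) \<longlonglongrightarrow> 1)) \<and>
     (\<forall>a :: nat \<Rightarrow> real.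
        (\<forall>i\<ge>1. 0 < a i \<and> a i < 1) \<longrightarrow>
        (\<exists>p \<psi>. zero_extension a p \<and> is_sentence \<psi> \<and> order_free \<psi> \<and>
           liminf (\<lambda>n. ereal (sat_prob n p \<psi>)) = 0 \<and>
           limsup (\<lambda>n. ereal (sat_prob n p \<psi>)) = 1))"
proof (intro conjI allI impI)
  fix p :: "nat \<Rightarrow> real" and \<psi>
  assume p: "(\<forall>i\<ge>1. 0 \<le> p i \<and> p i \<le> 1) \<and> finite {i. i \<ge> 1 \<and> p i \<noteq> 0}" and \<psi>: "is_sentence \<psi>"
  show "(\<lambda>n. sat_prob n p \<psi>) \<longlonglongrightarrow> 0 \<or> (\<lambda>n. sat_prob n p \<psi>) \<longlonglongrightarrow> 1"
    by (rule zero_one_law_of_finite_support) (use p \<psi> in simp_all)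
next
  fix a :: "nat \<Rightarrow> real"
  assume a: "\<forall>i\<ge>1. 0 < a i \<and> a i < 1"
  show "\<exists>p \<psi>. zero_extension a p \<and> is_sentence \<psi> \<and> order_free \<psi> \<and>
      liminf (\<lambda>n. ereal (sat_prob n p \<psi>)) = 0 \<and> limsup (\<lambda>n. ereal (sat_prob n p \<psi>)) = 1"
    by (rule no_convergence_for_sparse_extension) (use a in simp)
qed

end
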